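(* Let $F$ be a vertex-critical graph with $\chi(F)\geq 3$, and let $h\geq 2$ be an integer. Then, for all sufficiently large $n$, $$\mathrm{ex}(n,hF)=\max_{1\leq \ell\leq h}\left\{\binom{\ell-1}{2}+(\ell-1)(n-\ell+1)+\mathrm{ex}(n-\ell+1,F)\right\}=\binom{h-1}{2}+(h-1)(n-h+1)+\mathrm{ex}(n-h+1,F).$$ Moreover, every graph in $\mathrm{EX}(n,hF)$ is of the form $K_{h-1}\prod H$, where $H\in\mathrm{EX}(n-h+1,F)$.
   Context: All graphs are finite, simple and undirected; $\chi(G)$ is the chromatic number. For a graph $F$, a graph $G$ is $F$-free if it contains no subgraph isomorphic to $F$; $\mathrm{EX}(n,F)$ is the set of $F$-free graphs on $n$ vertices with the maximum possible number of edges, and $\mathrm{ex}(n,F)$ is the number of edges of any graph in $\mathrm{EX}(n,F)$. A graph $F$ is vertex-critical if there is a vertex $u$ of $F$ with $\chi(F-u)=\chi(F)-1$. $hF$ denotes the vertex-disjoint union of $h$ copies of $F$. For graphs $G_1,G_2$, $G_1\prod G_2$ denotes the join: the disjoint union of $G_1$ and $G_2$ together with all edges between $V(G_1)$ and $V(G_2)$. $K_m$ is the complete graph on $m$ vertices, and $\binom{a}{2}=0$ for $a\in\{0,1\}$. *)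

theory Defs
  imports Complex_Main
begin

type_synonym 'a graph = "'a set \<times> 'a set set"

abbreviation verts :: "'a graph \<Rightarrow> 'a set" where "verts G \<equiv> fst G"
abbreviation edges :: "'a graph \<Rightarrow> 'a set set" where "edges G \<equiv> snd G"

definition sgraph :: "'a graph \<Rightarrow> bool" where
  "sgraph G \<longleftrightarrow> finite (verts G) \<and> (\<forall>e\<in>edges G. e \<subseteq> verts G \<and> card e = 2)"

definition proper_coloring :: "'a graph \<Rightarrow> nat \<Rightarrow> ('a \<Rightarrow> nat) \<Rightarrow> bool" where
  "proper_coloring G k c \<longleftrightarrow>
     c ` verts G \<subseteq> {..<k} \<and> (\<forall>u v. {u, v} \<in> edges G \<longrightarrow> c u \<noteq> c v)"

definition chromatic_number :: "'a graph \<Rightarrow> nat" where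
  "chromatic_number G = (LEAST k. \<exists>c. proper_coloring G k c)"

definition del_vert :: "'a graph \<Rightarrow> 'a \<Rightarrow> 'a graph" where
  "del_vert G u = (verts G - {u}, {e \<in> edges G. u \<notin> e})"

definition vertex_critical :: "'a graph \<Rightarrow> bool" where
  "vertex_critical G \<longleftrightarrow>
     (\<exists>u\<in>verts G. chromatic_number (del_vert G u) = chromatic_number G - 1)"

definition subgraph :: "'a graph \<Rightarrow> 'a graph \<Rightarrow> bool" where
  "subgraph H G \<longleftrightarrow> sgraph H \<and> verts H \<subseteq> verts G \<and> edges H \<subseteq> edges G"

definition isomorphic :: "'a graph \<Rightarrow> 'b graph \<Rightarrow> bool" where
  "isomorphic G H \<longleftrightarrow>
     (\<exists>f. bij_betw f (verts G) (verts H) \<and> edges H = (\<lambda>e. f ` e) ` edges G)"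

definition free_of :: "'a graph \<Rightarrow> 'b graph \<Rightarrow> bool" where
  "free_of F G \<longleftrightarrow> \<not> (\<exists>H. subgraph H G \<and> isomorphic F H)"

text \<open>
  Host graphs have vertices of type \<^typ>\<open>nat\<close>; every finite graph is isomorphic to such a graph.
  The vertex set itself is only constrained to have \<open>n\<close> elements.
\<close>

definition EX_set :: "nat \<Rightarrow> 'a graph \<Rightarrow> nat graph set" where
  "EX_set n F = {G. sgraph G \<and> card (verts G) = n \<and> free_of F G \<and>
     (\<forall>G' :: nat graph. sgraph G' \<and> card (verts G') = n \<and> free_of F G' \<longrightarrow>
        card (edges G') \<le> card (edges G))}"

text \<open>The description is well defined whenever some \<open>F\<close>-free graph on \<open>n\<close> vertices exists.\<close>

definition ex_num :: "nat \<Rightarrow> 'a graph \<Rightarrow> nat" where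
  "ex_num n F = (THE m. \<exists>G\<in>EX_set n F. card (edges G) = m)"

definition copies :: "nat \<Rightarrow> 'a graph \<Rightarrow> (nat \<times> 'a) graph" where
  "copies h F = ({..<h} \<times> verts F, {Pair i ` e | i e. i < h \<and> e \<in> edges F})"

definition join :: "'a graph \<Rightarrow> 'b graph \<Rightarrow> ('a + 'b) graph" where
  "join G H = (verts G <+> verts H,
     (\<lambda>e. Inl ` e) ` edges G \<union> (\<lambda>e. Inr ` e) ` edges H \<union>
     {{Inl u, Inr v} | u v. u \<in> verts G \<and> v \<in> verts H})"

definition complete_graph :: "nat \<Rightarrow> nat graph" where
  "complete_graph m = ({..<m}, {e. e \<subseteq> {..<m} \<and> card e = 2})"

lemma card_edges_EX_set:
  assumes "G \<in> EX_set n F"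
  shows "card (edges G) = ex_num n F"
  unfolding ex_num_def
proof (rule sym, rule the_equality)
  show "\<exists>H\<in>EX_set n F. card (edges H) = card (edges G)" using assms by blast
next
  fix m assume "\<exists>H\<in>EX_set n F. card (edges H) = m"
  then obtain H where "H \<in> EX_set n F" "card (edges H) = m" by blast
  then show "m = card (edges G)" using assms unfolding EX_set_def mem_Collect_eq by (metis le_antisym)
qed

lemma EX_set_nonempty:
  assumes "sgraph (G :: nat graph)" "card (verts G) = n" "free_of F G"
  shows "EX_set n F \<noteq> {}"
proof -
  let ?P = "\<lambda>G :: nat graph. sgraph G \<and> card (verts G) = n \<and> free_of F G"
  have bnd: "\<forall>G. ?P G \<longrightarrow> card (edges G) < Suc (2 ^ n)"
  proof (intro allI impI)
    fix G assume P: "?P G"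
    then have "edges G \<subseteq> Pow (verts G)" "finite (verts G)" by (auto simp: sgraph_def)
    then have "card (edges G) \<le> card (Pow (verts G))" by (intro card_mono) auto
    then show "card (edges G) < Suc (2 ^ n)" using P \<open>finite (verts G)\<close> by (simp add: card_Pow)
  qed
  have "?P G" using assms by blast
  from ex_has_greatest_nat[of ?P G "\<lambda>G. card (edges G)", OF this bnd]
  obtain M where "?P M" "\<forall>G'. ?P G' \<longrightarrow> card (edges G') \<le> card (edges M)" by blast
  then have "M \<in> EX_set n F" by (simp add: EX_set_def)
  then show ?thesis by blast
qed

end

theory Submission
  imports Defs
begin

text \<open>
  Write \<open>\<chi>(F) = r + 1\<close>, \<open>p = 1 - 1/r\<close> and \<open>k = |F|\<close>, and let \<open>A\<close> be the set of vertices of degree at least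
  \<open>(p + \<delta>) n\<close> in an extremal \<open>hF\<close>-free graph \<open>G\<close>. By the Erdos--Stone theorem almost all
  degrees in \<open>G\<close> are at least \<open>(p - \<epsilon>) n\<close>, so the neighbourhood of a vertex \<open>v \<in> A\<close> contains a
  complete \<open>r\<close>-partite graph \<open>K\<^sub>r(k)\<close> even after deleting boundedly many vertices. As \<open>F\<close> is vertex-critical,
  this gives a copy of \<open>F\<close> through \<open>v\<close> that avoids any prescribed bounded set. Hence disjoint copies of
  \<open>F\<close> outside \<open>A\<close> together with the vertices of \<open>A\<close> number at most \<open>h - 1\<close>. If \<open>|A| = h - 1\<close>, then \<open>G - A\<close> is
  \<open>F\<close>-free, and counting edges shows that \<open>G\<close> is \<open>K\<^bsub>h-1\<^esub>\<close> joined to an extremal \<open>F\<close>-free graph.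

  If \<open>|A| < h - 1\<close>, deleting \<open>A\<close> and the boundedly many vertices of a maximal packing outside \<open>A\<close>, all of
  degree below \<open>(p + \<delta>) n\<close>, leaves an \<open>F\<close>-free graph, so \<open>G\<close> has too few edges. This comparison needs
  \<open>ex(n + 1, F) \<ge> ex(n, F) + (p - \<epsilon>) n\<close>: in an extremal \<open>F\<close>-free graph some \<open>k\<close> vertices have a common
  neighbourhood \<open>W\<close> of size at least \<open>(p - \<epsilon>) n\<close>, and a new vertex joined to \<open>W\<close> creates no copy of \<open>F\<close>.
\<close>

subsection \<open>Degrees and complete multipartite subgraphs\<close>

definition nbs :: "'a graph \<Rightarrow> 'a \<Rightarrow> 'a set" where
  "nbs G v = {x \<in> verts G. {v, x} \<in> edges G}"

definition induced :: "'a graph \<Rightarrow> 'a set \<Rightarrow> 'a graph" where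
  "induced G S = (S, {e \<in> edges G. e \<subseteq> S})"

text \<open>The parts of a copy of K_r(t), not necessarily induced. In a simple graph the parts are
  automatically disjoint, since a vertex common to two of them would carry a loop.\<close>

definition blowup_parts :: "'a graph \<Rightarrow> nat \<Rightarrow> nat \<Rightarrow> (nat \<Rightarrow> 'a set) \<Rightarrow> bool" where
  "blowup_parts G r t P \<longleftrightarrow> (\<forall>i<r. P i \<subseteq> verts G \<and> card (P i) = t) \<and>
     (\<forall>i<r. \<forall>j<r. i \<noteq> j \<longrightarrow> (\<forall>x\<in>P i. \<forall>y\<in>P j. {x, y} \<in> edges G))"

definition has_blowup :: "'a graph \<Rightarrow> nat \<Rightarrow> nat \<Rightarrow> bool" where
  "has_blowup G r t \<longleftrightarrow> (\<exists>P. blowup_parts G r t P)"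

text \<open>Injective homomorphisms stand in for the subgraph-and-isomorphism form of
  \<open>free_of\<close>, because copies of \<open>F\<close> are later restricted, glued and altered
  at one vertex as maps. The link is \<open>free_of_iff\<close>.\<close>

definition embeds_via :: "('a \<Rightarrow> 'b) \<Rightarrow> 'a graph \<Rightarrow> 'b graph \<Rightarrow> bool" where
  "embeds_via f F G \<longleftrightarrow>
     inj_on f (verts F) \<and> f ` verts F \<subseteq> verts G \<and> (\<forall>e\<in>edges F. f ` e \<in> edges G)"

lemma sgraph_finite_edges:
  assumes "sgraph G" shows "finite (edges G)"
proof (rule finite_subset)
  show "edges G \<subseteq> Pow (verts G)" using assms by (auto simp: sgraph_def)
  show "finite (Pow (verts G))" using assms by (simp add: sgraph_def)
qed

lemma sgraph_no_loop: "sgraph G \<Longrightarrow> {x, x} \<notin> edges G"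
  by (force simp: sgraph_def)

lemma sgraph_edgeE:
  assumes "sgraph G" "e \<in> edges G"
  obtains x y where "e = {x, y}" "x \<noteq> y" "x \<in> verts G" "y \<in> verts G"
  using assms by (auto simp: sgraph_def card_2_iff)

lemma sgraph_induced: "sgraph G \<Longrightarrow> S \<subseteq> verts G \<Longrightarrow> sgraph (induced G S)"
  by (auto simp: sgraph_def induced_def intro: finite_subset)

lemma verts_induced [simp]: "verts (induced G S) = S"
  by (simp add: induced_def)

lemma edges_induced [simp]: "edges (induced G S) = {e \<in> edges G. e \<subseteq> S}"
  by (simp add: induced_def)

lemma nbs_induced: "S \<subseteq> verts G \<Longrightarrow> x \<in> S \<Longrightarrow> nbs (induced G S) x = nbs G x \<inter> S"
  by (auto simp: nbs_def)

lemma nbs_subset: "nbs G v \<subseteq> verts G"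
  by (auto simp: nbs_def)

lemma finite_nbs [simp]: "sgraph G \<Longrightarrow> finite (nbs G v)"
  by (auto simp: nbs_def sgraph_def)

lemma mem_nbs_sym: "sgraph G \<Longrightarrow> x \<in> nbs G y \<Longrightarrow> y \<in> nbs G x"
  by (auto simp: nbs_def sgraph_def insert_commute)

lemma card_incident_edges:
  assumes "sgraph G"
  shows "card {e \<in> edges G. v \<in> e} = card (nbs G v)"
proof -
  have "{e \<in> edges G. v \<in> e} = (\<lambda>x. {v, x}) ` nbs G v"
  proof (intro equalityI subsetI)
    fix e assume e: "e \<in> {e \<in> edges G. v \<in> e}"
    then obtain x y where xy: "e = {x, y}" "x \<in> verts G" "y \<in> verts G"
      using sgraph_edgeE[OF assms] by blast
    then have "e = {v, x} \<or> e = {v, y}" using e by auto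
    then show "e \<in> (\<lambda>x. {v, x}) ` nbs G v"
      using e xy(2,3) by (auto simp: nbs_def)
  qed (auto simp: nbs_def)
  moreover have "inj_on (\<lambda>x. {v, x}) (nbs G v)" by (auto simp: inj_on_def doubleton_eq_iff)
  ultimately show ?thesis by (simp add: card_image)
qed

text \<open>The edges meeting \<open>X\<close> are covered by the stars of its vertices; an edge
  inside \<open>X\<close> is counted twice, hence only an inequality.\<close>

lemma card_edges_le_delete:
  assumes "sgraph G" "X \<subseteq> verts G"
  shows "card (edges G) \<le> card (edges (induced G (verts G - X))) + (\<Sum>v\<in>X. card (nbs G v))"
proof -
  have fX: "finite X" using assms by (auto simp: sgraph_def intro: finite_subset)
  have fE: "finite (edges G)" using assms(1) by (rule sgraph_finite_edges)
  have "edges G \<subseteq> edges (induced G (verts G - X)) \<union> (\<Union>v\<in>X. {e \<in> edges G. v \<in> e})"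
    using assms by (fastforce simp: sgraph_def)
  then have "card (edges G) \<le> card (edges (induced G (verts G - X)) \<union> (\<Union>v\<in>X. {e \<in> edges G. v \<in> e}))"
    using fE fX by (intro card_mono) auto
  also have "\<dots> \<le> card (edges (induced G (verts G - X))) + card (\<Union>v\<in>X. {e \<in> edges G. v \<in> e})"
    by (rule card_Un_le)
  also have "card (\<Union>v\<in>X. {e \<in> edges G. v \<in> e}) \<le> (\<Sum>v\<in>X. card {e \<in> edges G. v \<in> e})"
    using fX by (rule card_UN_le)
  finally show ?thesis using card_incident_edges[OF assms(1)] by simp
qed

lemma card_edges_le_square:
  assumes "sgraph G"
  shows "2 * real (card (edges G)) \<le> real (card (verts G)) ^ 2"
proof -
  have fin: "finite (verts G)" using assms by (simp add: sgraph_def)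
  have "card (edges G) \<le> card {e. e \<subseteq> verts G \<and> card e = 2}"
    using assms fin by (intro card_mono) (auto simp: sgraph_def)
  also have "\<dots> = card (verts G) choose 2" using fin by (rule n_subsets)
  finally have "2 * card (edges G) \<le> card (verts G) * (card (verts G) - 1)"
    by (simp add: choose_two)
  also have "\<dots> \<le> card (verts G) ^ 2" by (simp add: power2_eq_square)
  finally have "real (2 * card (edges G)) \<le> real (card (verts G) ^ 2)" by (rule of_nat_mono)
  then show ?thesis by simp
qed

lemma sum_degrees_eq:
  assumes "sgraph G" "S \<subseteq> verts G"
  shows "(\<Sum>v\<in>S. card (nbs G v)) = (\<Sum>x\<in>verts G. card (nbs G x \<inter> S))"
proof -
  have fin: "finite (verts G)" "finite S" using assms by (auto simp: sgraph_def intro: finite_subset)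
  have "(\<Sum>v\<in>S. card (nbs G v)) = (\<Sum>v\<in>S. \<Sum>x\<in>verts G. if {v, x} \<in> edges G then 1 else 0)"
    using fin by (intro sum.cong) (auto simp: nbs_def sum.If_cases Collect_conj_eq Int_commute)
  also have "\<dots> = (\<Sum>x\<in>verts G. \<Sum>v\<in>S. if {v, x} \<in> edges G then 1 else 0)"
    by (rule sum.swap)
  also have "\<dots> = (\<Sum>x\<in>verts G. card (nbs G x \<inter> S))"
  proof (rule sum.cong[OF refl])
    fix x assume "x \<in> verts G"
    have "nbs G x \<inter> S = S \<inter> {v. {v, x} \<in> edges G}"
      using assms by (auto simp: nbs_def insert_commute)
    then show "(\<Sum>v\<in>S. if {v, x} \<in> edges G then 1 else 0) = card (nbs G x \<inter> S)"
      using fin by (simp add: sum.If_cases)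
  qed
  finally show ?thesis .
qed

lemma blowup_parts_induced:
  "S \<subseteq> verts G \<Longrightarrow> blowup_parts (induced G S) r t P \<Longrightarrow> blowup_parts G r t P"
  by (simp add: blowup_parts_def) (meson order_trans)

lemma has_blowup_induced: "S \<subseteq> verts G \<Longrightarrow> has_blowup (induced G S) r t \<Longrightarrow> has_blowup G r t"
  unfolding has_blowup_def using blowup_parts_induced by blast

text \<open>Pigeonhole on traces: a vertex meets the union \<open>K\<close> of the parts in one of
  at most 2^(rT) sets, so \<open>t\<close> vertices of \<open>U\<close> share a trace
  \<open>Y\<close>. They form the new part, and \<open>Y\<close> still contains \<open>t\<close>
  vertices of every old part.\<close>

lemma has_blowup_extend:
  assumes G: "sgraph G" and parts: "blowup_parts G r T P"
    and U: "t * 2 ^ (r * T) < card {x \<in> verts G. \<forall>i<r. t \<le> card (nbs G x \<inter> P i)}"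
  shows "has_blowup G (Suc r) t"
proof -
  have P: "P i \<subseteq> verts G \<and> card (P i) = T" if "i < r" for i
    using parts that by (simp add: blowup_parts_def)
  have PP: "{x, y} \<in> edges G" if "i < r" "j < r" "i \<noteq> j" "x \<in> P i" "y \<in> P j" for i j x y
    using parts that by (simp add: blowup_parts_def)
  define K where "K = (\<Union>i<r. P i)"
  define U where "U = {x \<in> verts G. \<forall>i<r. t \<le> card (nbs G x \<inter> P i)}"
  define f where "f = (\<lambda>Y. {x \<in> U. nbs G x \<inter> K = Y})"
  have finV: "finite (verts G)" using G by (simp add: sgraph_def)
  have finP: "finite (P i)" if "i < r" for i using P[OF that] finV by (meson finite_subset)
  have finK: "finite K" using finP by (auto simp: K_def)
  have finU: "finite U" using finV by (simp add: U_def)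
  have "card K \<le> (\<Sum>i<r. card (P i))" unfolding K_def by (rule card_UN_le) simp
  also have "\<dots> = r * T" using P by simp
  finally have "card K \<le> r * T" .
  then have cK: "card (Pow K) \<le> 2 ^ (r * T)"
    unfolding card_Pow[OF finK] by (intro power_increasing) auto
  have "\<exists>Y\<in>Pow K. t \<le> card (f Y)"
  proof (rule ccontr)
    assume neg: "\<not> ?thesis"
    have "x \<in> f (nbs G x \<inter> K)" if "x \<in> U" for x using that by (simp add: f_def)
    then have "U \<subseteq> (\<Union>Y\<in>Pow K. f Y)" by blast
    then have "card U \<le> card (\<Union>Y\<in>Pow K. f Y)"
      using finK finU by (intro card_mono) (simp_all add: f_def)
    also have "\<dots> \<le> (\<Sum>Y\<in>Pow K. card (f Y))" using finK by (intro card_UN_le) simp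
    also have "\<dots> \<le> (\<Sum>Y\<in>Pow K. t)" using neg by (intro sum_mono) (meson linear)
    also have "\<dots> \<le> t * 2 ^ (r * T)" using mult_le_mono1[OF cK, of t] by (simp add: mult.commute)
    finally show False using U by (simp add: U_def)
  qed
  then obtain Y where Y: "t \<le> card (f Y)" by blast
  then obtain Q where Q: "Q \<subseteq> f Y" "card Q = t" by (meson obtain_subset_with_card_n)
  show ?thesis
  \<comment> \<open>For \<open>t = 0\<close> the set \<open>Q\<close> is empty and offers no vertex
    from which the sizes of the sets \<open>Y \<inter> P i\<close> could be read off.\<close>
  proof (cases "t = 0")
    case True
    then show ?thesis unfolding has_blowup_def blowup_parts_def by (intro exI[of _ "\<lambda>_. {}"]) simp
  next
    case False
    then obtain q where q: "q \<in> Q" using Q by fastforce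
    have "\<exists>R. R \<subseteq> Y \<inter> P i \<and> card R = t" if "i < r" for i
    proof -
      have "t \<le> card (nbs G q \<inter> P i)" using q Q that by (auto simp: f_def U_def)
      also have "nbs G q \<inter> P i = Y \<inter> P i" using q Q that by (auto simp: f_def K_def)
      finally show ?thesis by (meson obtain_subset_with_card_n)
    qed
    then obtain R where R: "\<And>i. i < r \<Longrightarrow> R i \<subseteq> Y \<inter> P i \<and> card (R i) = t" by metis
    have QR: "{x, y} \<in> edges G \<and> {y, x} \<in> edges G" if "x \<in> Q" "i < r" "y \<in> R i" for x y i
    proof -
      have "y \<in> nbs G x" using that Q R[OF that(2)] by (auto simp: f_def)
      then show ?thesis by (auto simp: nbs_def insert_commute)
    qed
    have RR: "{x, y} \<in> edges G" if "i < r" "j < r" "i \<noteq> j" "x \<in> R i" "y \<in> R j" for i j x y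
      using PP[OF that(1-3), of x y] R[OF that(1)] R[OF that(2)] that(4,5) by blast
    show ?thesis unfolding has_blowup_def blowup_parts_def
    proof (intro exI[of _ "R(r := Q)"] conjI allI impI ballI)
      fix i assume "i < Suc r"
      then show "(R(r := Q)) i \<subseteq> verts G" "card ((R(r := Q)) i) = t"
        using R[of i] P[of i] Q by (auto simp: f_def U_def less_Suc_eq)
    next
      fix i j x y assume "i < Suc r" "j < Suc r" "i \<noteq> j" "x \<in> (R(r := Q)) i" "y \<in> (R(r := Q)) j"
      then show "{x, y} \<in> edges G"
        using QR RR by (auto simp: less_Suc_eq split: if_splits)
    qed
  qed
qed

subsection \<open>The Erdos--Stone theorem\<close>

text \<open>Double counting of the edges leaving the parts. A vertex outside \<open>U\<close> has
  fewer than \<open>t\<close> neighbours in some part, so it contributes at most (r - 1)T + t, while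
  the degrees demand (r - 1)T + r\<epsilon>T on average. Hence \<open>U\<close> has at least
  \<epsilon>n/2 elements and \<open>has_blowup_extend\<close> applies.\<close>

lemma Erdos_Stone_step:
  fixes \<epsilon> :: real
  assumes r: "1 \<le> r" and \<epsilon>: "0 < \<epsilon>"
  shows "\<exists>T N. \<forall>(G :: 'a graph) P. sgraph G \<longrightarrow> N \<le> card (verts G) \<longrightarrow> blowup_parts G r T P \<longrightarrow>
      (\<forall>i<r. \<forall>v\<in>P i. (1 - 1 / real r + \<epsilon>) * card (verts G) \<le> card (nbs G v)) \<longrightarrow>
      has_blowup G (Suc r) t"
proof -
  \<comment> \<open>\<open>T\<close> is so large that \<open>t\<close> uses up at most half of the
    surplus \<epsilon>T; \<open>N\<close> is so large that \<epsilon>n/2 exceeds the pigeonhole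
    threshold of \<open>has_blowup_extend\<close>.\<close>
  obtain T :: nat where T: "2 * real t / \<epsilon> + 1 < real T" using reals_Archimedean2 by blast
  obtain N :: nat where N: "2 * real (t * 2 ^ (r * T)) / \<epsilon> < real N" using reals_Archimedean2 by blast
  have "0 \<le> 2 * real t / \<epsilon>" using \<epsilon> by simp
  then have T0: "0 < real T" using T by linarith
  have Tt: "2 * real t \<le> \<epsilon> * T" using T \<epsilon> by (simp add: field_simps)
  show ?thesis
  proof (rule exI[of _ T], rule exI[of _ N], intro allI impI)
    fix G :: "'a graph" and P
    let ?n = "real (card (verts G))"
    define U where "U = {x \<in> verts G. \<forall>i<r. t \<le> card (nbs G x \<inter> P i)}"
    assume G: "sgraph G" and n: "N \<le> card (verts G)" and parts: "blowup_parts G r T P"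
      and deg: "\<forall>i<r. \<forall>v\<in>P i. (1 - 1 / real r + \<epsilon>) * ?n \<le> card (nbs G v)"
    have P: "P i \<subseteq> verts G \<and> card (P i) = T" if "i < r" for i
      using parts that by (simp add: blowup_parts_def)
    have finV: "finite (verts G)" using G by (simp add: sgraph_def)
    have finP: "finite (P i)" if "i < r" for i using P[OF that] finV by (meson finite_subset)
    have le_T: "card (nbs G x \<inter> P i) \<le> T" if "i < r" for x i
      using card_mono[of "P i" "nbs G x \<inter> P i"] finP[OF that] P[OF that] by simp
    have "real r * (T * ((1 - 1 / real r + \<epsilon>) * ?n)) = (\<Sum>i<r. \<Sum>v\<in>P i. (1 - 1 / real r + \<epsilon>) * ?n)"
      using P by simp
    also have "\<dots> \<le> (\<Sum>i<r. \<Sum>v\<in>P i. real (card (nbs G v)))"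
      using deg by (intro sum_mono) simp
    also have "\<dots> = (\<Sum>i<r. \<Sum>x\<in>verts G. real (card (nbs G x \<inter> P i)))"
    proof (rule sum.cong[OF refl])
      fix i assume "i \<in> {..<r}"
      then have "(\<Sum>v\<in>P i. card (nbs G v)) = (\<Sum>x\<in>verts G. card (nbs G x \<inter> P i))"
        using P by (intro sum_degrees_eq[OF G]) simp
      then show "(\<Sum>v\<in>P i. real (card (nbs G v))) = (\<Sum>x\<in>verts G. real (card (nbs G x \<inter> P i)))"
        by (metis of_nat_sum)
    qed
    also have "\<dots> = (\<Sum>x\<in>verts G. \<Sum>i<r. real (card (nbs G x \<inter> P i)))"
      by (rule sum.swap)
    also have "\<dots> \<le> (\<Sum>x\<in>verts G. (real r - 1) * T + t + (if x \<in> U then real T else 0))"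
    proof (rule sum_mono)
      fix x assume x: "x \<in> verts G"
      show "(\<Sum>i<r. real (card (nbs G x \<inter> P i))) \<le> (real r - 1) * T + t + (if x \<in> U then real T else 0)"
      proof (cases "x \<in> U")
        case True
        have "(\<Sum>i<r. real (card (nbs G x \<inter> P i))) \<le> (\<Sum>i<r. real T)"
          using le_T by (intro sum_mono) simp
        then show ?thesis using True by (simp add: algebra_simps)
      next
        case False
        then obtain j where j: "j < r" "card (nbs G x \<inter> P j) < t"
          using x by (auto simp: U_def not_le)
        have "(\<Sum>i<r. real (card (nbs G x \<inter> P i))) =
            real (card (nbs G x \<inter> P j)) + (\<Sum>i\<in>{..<r}-{j}. real (card (nbs G x \<inter> P i)))"
          using j by (intro sum.remove) auto
        also have "\<dots> \<le> t + (\<Sum>i\<in>{..<r}-{j}. real T)"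
          using j le_T by (intro add_mono sum_mono) auto
        also have "\<dots> = t + (real r - 1) * T" using j r by (simp add: of_nat_diff)
        finally show ?thesis using False by simp
      qed
    qed
    also have "\<dots> = ?n * ((real r - 1) * T + t) + card U * T"
    proof -
      have "verts G \<inter> U = U" by (auto simp: U_def)
      then have "(\<Sum>x\<in>verts G. if x \<in> U then real T else 0) = card U * T"
        using finV by (simp add: sum.If_cases Int_def[symmetric] Collect_conj_eq)
      then show ?thesis by (simp add: sum.distrib)
    qed
    finally have "real r * (T * ((1 - 1 / real r + \<epsilon>) * ?n)) \<le> ?n * ((real r - 1) * T + t) + card U * T" .
    moreover have "real r * (T * ((1 - 1 / real r + \<epsilon>) * ?n)) = ?n * ((real r - 1) * T) + ?n * (r * (\<epsilon> * T))"
      using r by (simp add: field_simps)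
    ultimately have 1: "?n * (r * (\<epsilon> * T)) \<le> ?n * t + card U * T" by (simp add: algebra_simps)
    have "?n * (1 * (\<epsilon> * T)) \<le> ?n * (r * (\<epsilon> * T))"
      using r \<epsilon> by (intro mult_left_mono mult_right_mono) auto
    moreover have "?n * t \<le> ?n * (\<epsilon> * T / 2)" using Tt by (intro mult_left_mono) auto
    ultimately have "(?n * \<epsilon> / 2) * T \<le> card U * T" using 1 by (simp add: algebra_simps)
    then have "?n * \<epsilon> / 2 \<le> card U" using T0 by simp
    moreover have "real (t * 2 ^ (r * T)) < ?n * \<epsilon> / 2"
    proof -
      have "2 * real (t * 2 ^ (r * T)) / \<epsilon> < ?n" using N n by linarith
      then show ?thesis using \<epsilon> by (simp add: field_simps)
    qed
    ultimately have "t * 2 ^ (r * T) < card U" by linarith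
    then show "has_blowup G (Suc r) t"
      unfolding U_def by (rule has_blowup_extend[OF G parts])
  qed
qed

text \<open>Induction on \<open>r\<close>. For \<open>r = 1\<close> any \<open>T\<close> vertices
  serve as the single starting part. In the step, 1 - 1/r increases with r, so the degree condition
  for \<open>Suc r\<close> implies the one for \<open>r\<close>; this yields \<open>Suc r\<close>
  parts, and \<open>Erdos_Stone_step\<close> adds another.\<close>

lemma Erdos_Stone_min_degree:
  fixes \<epsilon> :: real
  assumes "1 \<le> r" and "0 < \<epsilon>"
  shows "\<exists>N. \<forall>G :: 'a graph. sgraph G \<longrightarrow> N \<le> card (verts G) \<longrightarrow>
     (\<forall>v\<in>verts G. (1 - 1 / real r + \<epsilon>) * card (verts G) \<le> card (nbs G v))
     \<longrightarrow> has_blowup G (Suc r) t"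
  using assms(1)
\<comment> \<open>The part size must vary: parts of size \<open>t\<close> are obtained from parts of
  the size \<open>T\<close> that \<open>Erdos_Stone_step\<close> prescribes.\<close>
proof (induction r arbitrary: t rule: nat_induct_at_least)
  case base
  obtain T N where TN: "\<forall>(G :: 'a graph) P. sgraph G \<longrightarrow> N \<le> card (verts G) \<longrightarrow> blowup_parts G 1 T P \<longrightarrow>
      (\<forall>i<1. \<forall>v\<in>P i. (1 - 1 / real 1 + \<epsilon>) * card (verts G) \<le> card (nbs G v)) \<longrightarrow>
      has_blowup G (Suc 1) t"
    using Erdos_Stone_step[of 1 \<epsilon> t, OF le_refl assms(2)] by blast
  show ?case
  proof (intro exI[of _ "max N T"] allI impI)
    fix G :: "'a graph"
    assume A: "sgraph G" "max N T \<le> card (verts G)"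
      "\<forall>v\<in>verts G. (1 - 1 / real 1 + \<epsilon>) * card (verts G) \<le> card (nbs G v)"
    then obtain Q where Q: "Q \<subseteq> verts G" "card Q = T"
      by (metis max.boundedE obtain_subset_with_card_n)
    show "has_blowup G (Suc 1) t"
    proof (rule TN[rule_format, of G "\<lambda>_. Q"])
      show "blowup_parts G 1 T (\<lambda>_. Q)" using Q by (simp add: blowup_parts_def)
    qed (use A Q in auto)
  qed
next
  case (Suc r)
  obtain T N where TN: "\<forall>(G :: 'a graph) P. sgraph G \<longrightarrow> N \<le> card (verts G) \<longrightarrow> blowup_parts G (Suc r) T P \<longrightarrow>
      (\<forall>i<Suc r. \<forall>v\<in>P i. (1 - 1 / real (Suc r) + \<epsilon>) * card (verts G) \<le> card (nbs G v)) \<longrightarrow>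
      has_blowup G (Suc (Suc r)) t"
    using Erdos_Stone_step[of "Suc r" \<epsilon> t, OF le_SucI[OF Suc.hyps] assms(2)] by blast
  obtain N' where N': "\<forall>G :: 'a graph. sgraph G \<longrightarrow> N' \<le> card (verts G) \<longrightarrow>
     (\<forall>v\<in>verts G. (1 - 1 / real r + \<epsilon>) * card (verts G) \<le> card (nbs G v))
     \<longrightarrow> has_blowup G (Suc r) T" using Suc.IH[of T] by (rule exE)
  have le: "1 - 1 / real r + \<epsilon> \<le> 1 - 1 / real (Suc r) + \<epsilon>"
    using Suc.hyps by (simp add: frac_le)
  show ?case
  proof (intro exI[of _ "max N N'"] allI impI)
    fix G :: "'a graph"
    assume A: "sgraph G" "max N N' \<le> card (verts G)"
      "\<forall>v\<in>verts G. (1 - 1 / real (Suc r) + \<epsilon>) * card (verts G) \<le> card (nbs G v)"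
    have "(1 - 1 / real r + \<epsilon>) * card (verts G) \<le> card (nbs G v)" if "v \<in> verts G" for v
    proof -
      have "(1 - 1 / real r + \<epsilon>) * card (verts G) \<le> (1 - 1 / real (Suc r) + \<epsilon>) * card (verts G)"
        by (rule mult_right_mono[OF le]) simp
      then show ?thesis using A(3) that by (meson order_trans)
    qed
    then have "has_blowup G (Suc r) T" using N'[rule_format, OF A(1)] A(2) by auto
    then obtain P where P: "blowup_parts G (Suc r) T P" unfolding has_blowup_def by (rule exE)
    show "has_blowup G (Suc (Suc r)) t"
    proof (rule TN[rule_format, OF A(1) _ P])
      fix i v assume "i < Suc r" "v \<in> P i"
      then have "v \<in> verts G" using P by (auto simp: blowup_parts_def)
      then show "(1 - 1 / real (Suc r) + \<epsilon>) * card (verts G) \<le> card (nbs G v)" using A(3) by (rule bspec[rotated])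
    qed (use A(2) in simp)
  qed
qed

text \<open>A set \<open>S\<close> maximising \<open>e(S) - c |S|\<^sup>2 / 2\<close> induces a subgraph of large minimum degree.\<close>

lemma dense_induced_subgraph:
  fixes c \<epsilon> :: real
  assumes G: "sgraph G" and c: "0 \<le> c" "c \<le> 1" and \<epsilon>: "0 \<le> \<epsilon>"
    and e: "(c + \<epsilon>) * real (card (verts G)) ^ 2 / 2 \<le> card (edges G)"
  obtains S where "S \<subseteq> verts G" "\<epsilon> * real (card (verts G)) ^ 2 \<le> real (card S) ^ 2"
    "\<And>v. v \<in> S \<Longrightarrow> c * card S - 1 \<le> card (nbs (induced G S) v)"
proof -
  define f where "f S = real (card (edges (induced G S))) - c * real (card S) ^ 2 / 2" for S
  have finV: "finite (verts G)" using G by (simp add: sgraph_def)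
  have fin: "finite (f ` Pow (verts G))" using finV by simp
  have "Max (f ` Pow (verts G)) \<in> f ` Pow (verts G)" using fin by (intro Max_in) auto
  then obtain S where S: "S \<subseteq> verts G" "f S = Max (f ` Pow (verts G))" by auto
  have max: "f S' \<le> f S" if "S' \<subseteq> verts G" for S'
    unfolding S(2) using that fin by (intro Max_ge) auto
  have sS: "sgraph (induced G S)" using G S(1) by (rule sgraph_induced)
  have finS: "finite S" using S(1) finV by (rule finite_subset)
  have "edges (induced G (verts G)) = edges G" using G by (auto simp: sgraph_def)
  \<comment> \<open>Comparing \<open>S\<close> with the whole vertex set shows that \<open>S\<close>
    spans at least \<epsilon>n^2/2 edges, which bounds its size from below.\<close>
  then have "\<epsilon> * real (card (verts G)) ^ 2 / 2 \<le> f (verts G)"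
    using e by (simp add: f_def algebra_simps add_divide_distrib)
  also have "\<dots> \<le> f S" by (rule max) simp
  also have "\<dots> \<le> card (edges (induced G S))" using c by (simp add: f_def)
  finally have 1: "\<epsilon> * real (card (verts G)) ^ 2 \<le> real (card S) ^ 2"
    using card_edges_le_square[OF sS] by simp
  \<comment> \<open>Deleting \<open>v\<close> cannot increase \<open>f\<close>, and the quadratic
    term drops by c|S| - c/2, which is at least c|S| - 1.\<close>
  have 2: "c * card S - 1 \<le> card (nbs (induced G S) v)" if v: "v \<in> S" for v
  proof -
    have "induced (induced G S) (S - {v}) = induced G (S - {v})" by (auto simp: induced_def)
    then have "card (edges (induced G S)) \<le> card (edges (induced G (S - {v}))) + card (nbs (induced G S) v)"
      using card_edges_le_delete[OF sS, of "{v}"] v by simp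
    then have "real (card (edges (induced G S))) \<le> card (edges (induced G (S - {v}))) + card (nbs (induced G S) v)"
      by linarith
    moreover have "f (S - {v}) \<le> f S" using S(1) by (intro max) auto
    moreover have "real (card (S - {v})) = real (card S) - 1"
      using v finS card_gt_0_iff[of S] by (auto simp: card_Diff_singleton of_nat_diff Suc_leI)
    ultimately have "c * real (card S) ^ 2 / 2 - c * (real (card S) - 1) ^ 2 / 2 \<le> card (nbs (induced G S) v)"
      by (simp add: f_def)
    then show ?thesis using c by (simp add: power2_eq_square algebra_simps diff_divide_distrib add_divide_distrib)
  qed
  show thesis using S(1) 1 2 by (rule that)
qed

text \<open>Reduction to minimum degree: half of \<epsilon> is spent on making the dense set
  \<open>S\<close> large. Of the other half, \<epsilon>/4 absorbs the loss of 1 in the degrees, and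
  \<epsilon>/4 is left for \<open>Erdos_Stone_min_degree\<close>.\<close>

lemma Erdos_Stone:
  fixes \<epsilon> :: real
  assumes r: "1 \<le> r" and \<epsilon>: "0 < \<epsilon>" "\<epsilon> \<le> 1 / r"
  shows "\<exists>N. \<forall>G :: 'a graph. sgraph G \<longrightarrow> N \<le> card (verts G) \<longrightarrow>
     (1 - 1 / real r + \<epsilon>) * real (card (verts G)) ^ 2 / 2 \<le> card (edges G) \<longrightarrow> has_blowup G (Suc r) t"
proof -
  obtain N where N: "\<forall>G :: 'a graph. sgraph G \<longrightarrow> N \<le> card (verts G) \<longrightarrow>
     (\<forall>v\<in>verts G. (1 - 1 / real r + \<epsilon> / 4) * card (verts G) \<le> card (nbs G v))
     \<longrightarrow> has_blowup G (Suc r) t"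
    using Erdos_Stone_min_degree[OF r, of "\<epsilon> / 4" t] \<epsilon> by auto
  \<comment> \<open>\<open>M\<close> bounds |S| from below, so that |S| \<ge> N and \<epsilon>|S|/4
    \<ge> 1. \<open>L\<close> enforces this through |S|^2 \<ge> \<epsilon>n^2/2 \<ge> \<epsilon>n/2
    > M^2.\<close>
  obtain M :: nat where M: "real N + 4 / \<epsilon> < real M" using reals_Archimedean2 by blast
  obtain L :: nat where L: "real M ^ 2 * 2 / \<epsilon> < real L" using reals_Archimedean2 by blast
  show ?thesis
  proof (intro exI[of _ "max 1 L"] allI impI)
    fix G :: "'a graph"
    assume G: "sgraph G" and n: "max 1 L \<le> card (verts G)"
      and e: "(1 - 1 / real r + \<epsilon>) * real (card (verts G)) ^ 2 / 2 \<le> card (edges G)"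
    let ?n = "real (card (verts G))"
    have "1 - 1 / real r + \<epsilon> / 2 + \<epsilon> / 2 = 1 - 1 / real r + \<epsilon>" by simp
    then have "(1 - 1 / real r + \<epsilon> / 2 + \<epsilon> / 2) * ?n ^ 2 / 2 \<le> card (edges G)" using e by presburger
    moreover have "0 \<le> 1 - 1 / real r + \<epsilon> / 2" "1 - 1 / real r + \<epsilon> / 2 \<le> 1" using \<epsilon> r by auto
    ultimately obtain S where S: "S \<subseteq> verts G" "\<epsilon> / 2 * ?n ^ 2 \<le> real (card S) ^ 2"
      and deg: "\<And>v. v \<in> S \<Longrightarrow> (1 - 1 / real r + \<epsilon> / 2) * card S - 1 \<le> card (nbs (induced G S) v)"
      using dense_induced_subgraph[OF G, of "1 - 1 / real r + \<epsilon> / 2" "\<epsilon> / 2"] \<epsilon> by auto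
    have "real M ^ 2 * 2 / \<epsilon> < ?n" using L n by linarith
    also have "?n * 1 \<le> ?n * ?n" using n by (intro mult_left_mono) auto
    then have "?n \<le> ?n ^ 2" by (simp add: power2_eq_square)
    finally have "real M ^ 2 < \<epsilon> / 2 * ?n ^ 2" using \<epsilon> by (simp add: field_simps)
    then have "real M ^ 2 < real (card S) ^ 2" using S(2) by simp
    then have MS: "real M < card S" by (rule power_less_imp_less_base) simp
    have "has_blowup (induced G S) (Suc r) t"
    proof (rule N[rule_format, OF sgraph_induced[OF G S(1)]])
      have "0 < 4 / \<epsilon>" using \<epsilon> by simp
      then have "real N \<le> real (card S)" using M MS by linarith
      then show "N \<le> card (verts (induced G S))" by simp
      fix v assume "v \<in> verts (induced G S)"
      then have "(1 - 1 / real r + \<epsilon> / 2) * card S - 1 \<le> card (nbs (induced G S) v)" by (simp add: deg)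
      moreover have "4 / \<epsilon> < card S" using M MS by linarith
      then have "1 \<le> \<epsilon> / 4 * card S" using \<epsilon> by (simp add: field_simps)
      ultimately show "(1 - 1 / real r + \<epsilon> / 4) * card (verts (induced G S)) \<le> card (nbs (induced G S) v)"
        by (simp add: algebra_simps)
    qed
    then show "has_blowup G (Suc r) t" by (rule has_blowup_induced[OF S(1)])
  qed
qed

section \<open>Degrees and large vertex sets in graphs near the Turan density\<close>

text \<open>Deleting just over \<epsilon>n vertices of low degree would cost so few edges that the
  density of the rest rises above 1 - 1/r + \<eta>, and the Erdos-Stone theorem would then give
  K_(r+1)(t).\<close>

lemma few_low_degree_vertices:
  fixes \<epsilon> :: real
  assumes r: "1 \<le> r" and \<epsilon>: "0 < \<epsilon>" "\<epsilon> \<le> 1 / 2"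
  shows "\<exists>\<eta>>0 :: real. \<exists>N. \<forall>G :: 'a graph. sgraph G \<longrightarrow> N \<le> card (verts G) \<longrightarrow>
     (1 - 1 / real r - \<eta>) * real (card (verts G)) ^ 2 / 2 \<le> card (edges G) \<longrightarrow> \<not> has_blowup G (Suc r) t \<longrightarrow>
     card {v \<in> verts G. card (nbs G v) < (1 - 1 / real r - \<epsilon>) * card (verts G)} \<le> \<epsilon> * card (verts G)"
proof -
  define p where "p = 1 - 1 / real r"
  have p: "0 \<le> p" "p \<le> 1" using r by (auto simp: p_def)
  \<comment> \<open>The square of \<epsilon> matches the gain of order \<epsilon>^2 n^2 from the
    deletion; the factor 1/r ensures \<eta> \<le> 1/r, as \<open>Erdos_Stone\<close>
    demands.\<close>
  define \<eta> where "\<eta> = \<epsilon> ^ 2 / (8 * r)"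
  have \<eta>0: "0 < \<eta>" using \<epsilon> r by (simp add: \<eta>_def)
  have \<epsilon>2: "\<epsilon> ^ 2 \<le> 1" using \<epsilon> by (simp add: power_le_one)
  then have \<eta>r: "\<eta> \<le> 1 / r" using r by (simp add: \<eta>_def field_simps)
  have \<eta>\<epsilon>: "8 * \<eta> \<le> \<epsilon> ^ 2"
    using r mult_left_mono[of 1 "real r" "\<epsilon> ^ 2"] by (simp add: \<eta>_def field_simps)
  obtain N where N: "\<forall>G :: 'a graph. sgraph G \<longrightarrow> N \<le> card (verts G) \<longrightarrow>
     (1 - 1 / real r + \<eta>) * real (card (verts G)) ^ 2 / 2 \<le> card (edges G) \<longrightarrow> has_blowup G (Suc r) t"
    using Erdos_Stone[OF r \<eta>0 \<eta>r, of t] by blast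
  obtain M :: nat where M: "4 / \<epsilon> < real M" using reals_Archimedean2 by blast
  show ?thesis
  proof (rule exI[of _ \<eta>], intro conjI exI[of _ "max M (2 * N + 2)"] allI impI)
    fix G :: "'a graph"
    let ?n = "real (card (verts G))"
    define L where "L = {v \<in> verts G. card (nbs G v) < (1 - 1 / real r - \<epsilon>) * ?n}"
    assume G: "sgraph G" and n: "max M (2 * N + 2) \<le> card (verts G)"
      and e: "(1 - 1 / real r - \<eta>) * ?n ^ 2 / 2 \<le> card (edges G)" and free: "\<not> has_blowup G (Suc r) t"
    have finV: "finite (verts G)" using G by (simp add: sgraph_def)
    have "4 / \<epsilon> < ?n" using M n by linarith
    then have n4: "4 < \<epsilon> * ?n" using \<epsilon> by (simp add: field_simps)
    have "card L \<le> \<epsilon> * ?n"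
    proof (rule ccontr)
      assume "\<not> card L \<le> \<epsilon> * ?n"
      \<comment> \<open>Exactly \<open>l\<close> vertices are deleted, not all of \<open>L\<close>,
        so that the quadratic loss pl^2 stays below l(\<epsilon>n + 1), about half of the gain
        2l\<epsilon>n.\<close>
      define l where "l = Suc (nat \<lfloor>\<epsilon> * ?n\<rfloor>)"
      have l: "\<epsilon> * ?n \<le> l" "l \<le> \<epsilon> * ?n + 1" using n4 by (auto simp: l_def) linarith+
      have "l \<le> card L" using \<open>\<not> card L \<le> \<epsilon> * ?n\<close> n4 by (simp add: l_def) linarith
      then obtain X where X: "X \<subseteq> L" "card X = l" by (meson obtain_subset_with_card_n)
      have XV: "X \<subseteq> verts G" using X by (auto simp: L_def)
      define S where "S = verts G - X"
      have SV: "S \<subseteq> verts G" by (auto simp: S_def)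
      have "card X \<le> card (verts G)" using XV finV by (rule card_mono[rotated])
      then have m: "real (card S) = ?n - l"
        using XV finV X by (simp add: S_def card_Diff_subset finite_subset of_nat_diff)
      have "\<epsilon> * ?n \<le> 1 / 2 * ?n" using \<epsilon> by (intro mult_right_mono) auto
      moreover have "2 * real N + 2 \<le> ?n" using n by linarith
      ultimately have mN: "N \<le> card S" using m l(2) by linarith
      have "(\<Sum>v\<in>X. real (card (nbs G v))) \<le> (\<Sum>v\<in>X. (p - \<epsilon>) * ?n)"
        using X by (intro sum_mono) (auto simp: L_def p_def)
      then have "(\<Sum>v\<in>X. real (card (nbs G v))) \<le> l * ((p - \<epsilon>) * ?n)" using X by simp
      moreover have "real (card (edges G)) \<le> card (edges (induced G S)) + (\<Sum>v\<in>X. real (card (nbs G v)))"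
        using card_edges_le_delete[OF G XV] unfolding S_def of_nat_sum[symmetric] of_nat_add[symmetric]
        by (simp only: of_nat_le_iff)
      ultimately have 1: "(p - \<eta>) * ?n ^ 2 - 2 * (l * ((p - \<epsilon>) * ?n)) \<le> 2 * real (card (edges (induced G S)))"
        using e unfolding p_def[symmetric] by (simp add: algebra_simps)
      \<comment> \<open>The remaining gain l\<epsilon>n - l pays for 2\<eta>n^2, since l\<epsilon>n
        is at least both 8\<eta>n^2 and 4l.\<close>
      have 2: "(p + \<eta>) * (?n - l) ^ 2 \<le> (p - \<eta>) * ?n ^ 2 - 2 * (l * ((p - \<epsilon>) * ?n))"
      proof -
        have a: "p * (real l * l) \<le> 1 * (real l * (\<epsilon> * ?n + 1))"
          using p l by (intro mult_mono mult_left_mono) auto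
        have "(?n - l) ^ 2 \<le> ?n ^ 2" using m by (intro power_mono) (use m in linarith)+
        then have b: "\<eta> * (?n - l) ^ 2 \<le> \<eta> * ?n ^ 2" using \<eta>0 by simp
        have c: "8 * \<eta> * ?n ^ 2 \<le> \<epsilon> ^ 2 * ?n ^ 2" using \<eta>\<epsilon> by (rule mult_right_mono) simp
        have d: "\<epsilon> ^ 2 * ?n ^ 2 \<le> l * (\<epsilon> * ?n)"
          using mult_right_mono[OF l(1), of "\<epsilon> * ?n"] \<epsilon> by (simp add: power2_eq_square algebra_simps)
        have f: "real l * 4 \<le> l * (\<epsilon> * ?n)" using n4 by (intro mult_left_mono) auto
        have "p * (?n - l) ^ 2 = p * ?n ^ 2 - 2 * (l * (p * ?n)) + p * (real l * l)"
          by (simp add: power2_eq_square algebra_simps)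
        then show ?thesis using a b c d f by (simp add: algebra_simps)
      qed
      have "has_blowup (induced G S) (Suc r) t"
      proof (rule N[rule_format, OF sgraph_induced[OF G SV]])
        show "N \<le> card (verts (induced G S))" using mN by simp
        show "(1 - 1 / real r + \<eta>) * real (card (verts (induced G S))) ^ 2 / 2 \<le> card (edges (induced G S))"
          using 1 2 unfolding p_def[symmetric] verts_induced m by linarith
      qed
      then show False using free has_blowup_induced[OF SV] by blast
    qed
    then show "card {v \<in> verts G. card (nbs G v) < (1 - 1 / real r - \<epsilon>) * ?n} \<le> \<epsilon> * ?n"
      unfolding L_def .
  qed (use \<eta>0 in simp)
qed

text \<open>A vertex outside \<open>L\<close> misses at most (1/r + \<epsilon>)n vertices. Relative
  to the size of \<open>R - L\<close>, which is about (1 - 1/r + \<delta>)n, this is less than a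
  fraction 1/(r - 1), so the minimum degree theorem for \<open>r - 1\<close> yields \<open>r\<close>
  parts inside \<open>R - L\<close>.\<close>

lemma blowup_in_large_set:
  fixes \<delta> :: real
  assumes r: "2 \<le> r" and \<delta>: "0 < \<delta>" "\<delta> \<le> 1"
  shows "\<exists>\<epsilon>>0 :: real. \<exists>N. \<forall>(G :: 'a graph) L R. sgraph G \<longrightarrow> N \<le> card (verts G) \<longrightarrow> R \<subseteq> verts G \<longrightarrow>
     real (card L) \<le> \<epsilon> * card (verts G) \<longrightarrow> finite L \<longrightarrow>
     (\<forall>v\<in>verts G - L. (1 - 1 / real r - \<epsilon>) * card (verts G) \<le> card (nbs G v)) \<longrightarrow>
     (1 - 1 / real r + \<delta>) * card (verts G) \<le> card R \<longrightarrow> has_blowup (induced G (R - L)) r t"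
proof -
  define q where "q = real r - 1"
  have q: "1 \<le> q" "real r = q + 1" using r by (auto simp: q_def)
  have q': "real (r - 1) = q" using r by (simp add: q_def of_nat_diff)
  define \<epsilon> where "\<epsilon> = \<delta> / (8 * q)"
  have \<epsilon>: "0 < \<epsilon>" "8 * (q * \<epsilon>) = \<delta>" using \<delta> q by (auto simp: \<epsilon>_def)
  have "\<epsilon> * 1 \<le> \<epsilon> * q" using \<epsilon> q by (intro mult_left_mono) auto
  then have \<epsilon>\<delta>: "8 * \<epsilon> \<le> \<delta>" using \<epsilon>(2) by (simp add: mult.commute)
  obtain N where N: "\<forall>G :: 'a graph. sgraph G \<longrightarrow> N \<le> card (verts G) \<longrightarrow>
     (\<forall>v\<in>verts G. (1 - 1 / real (r - 1) + \<epsilon>) * card (verts G) \<le> card (nbs G v))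
     \<longrightarrow> has_blowup G (Suc (r - 1)) t"
    using Erdos_Stone_min_degree[of "r - 1" \<epsilon> t, OF _ \<epsilon>(1)] r by fastforce
  show ?thesis
  proof (rule exI[of _ \<epsilon>], intro conjI exI[of _ "2 * N"] allI impI)
    fix G :: "'a graph" and L R
    let ?n = "real (card (verts G))"
    assume G: "sgraph G" and n: "2 * N \<le> card (verts G)" and R: "R \<subseteq> verts G"
      and L: "card L \<le> \<epsilon> * ?n" "finite L"
      and deg: "\<forall>v\<in>verts G - L. (1 - 1 / real r - \<epsilon>) * ?n \<le> card (nbs G v)"
      and cR: "(1 - 1 / real r + \<delta>) * ?n \<le> card R"
    have finV: "finite (verts G)" using G by (simp add: sgraph_def)
    define S where "S = R - L"
    have SV: "S \<subseteq> verts G" using R by (auto simp: S_def)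
    have finS: "finite S" using SV finV by (rule finite_subset)
    let ?m = "real (card S)"
    have "card R \<le> card S + card L"
      using card_Un_le[of S L] card_mono[of "S \<union> L" R] finS L(2) by (auto simp: S_def)
    then have m: "(1 - 1 / real r + \<delta> - \<epsilon>) * ?n \<le> ?m" using cR L(1) by (simp add: algebra_simps)
    have sS: "sgraph (induced G S)" by (rule sgraph_induced[OF G SV])
    have mn: "?m \<le> ?n" using card_mono[OF finV SV] by simp
    have "has_blowup (induced G S) (Suc (r - 1)) t"
    proof (rule N[rule_format, OF sS])
      have "1 / real r \<le> 1 / 2" using r by (simp add: field_simps)
      then have "1 / 2 \<le> 1 - 1 / real r + \<delta> - \<epsilon>" using \<epsilon>\<delta> \<epsilon>(1) by linarith
      then have "1 / 2 * ?n \<le> (1 - 1 / real r + \<delta> - \<epsilon>) * ?n" by (rule mult_right_mono) simp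
      then have "real (2 * N) / 2 \<le> ?m" using m n by linarith
      then show "N \<le> card (verts (induced G S))" by simp
      fix v assume "v \<in> verts (induced G S)"
      then have v: "v \<in> S" by simp
      have "card (nbs G v) \<le> card (nbs (induced G S) v) + card (verts G - S)"
      proof -
        have "nbs G v \<subseteq> nbs (induced G S) v \<union> (verts G - S)"
          using nbs_induced[OF SV v] nbs_subset[of G v] by auto
        then have "card (nbs G v) \<le> card (nbs (induced G S) v \<union> (verts G - S))"
          using finV sS by (intro card_mono) auto
        then show ?thesis using card_Un_le order_trans by blast
      qed
      moreover have "real (card (verts G - S)) = ?n - ?m"
        using SV finS card_mono[OF finV SV] by (simp add: card_Diff_subset of_nat_diff)
      moreover have "(1 - 1 / real r - \<epsilon>) * ?n \<le> card (nbs G v)" using deg v SV by (auto simp: S_def)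
      ultimately have d: "(1 - 1 / real r - \<epsilon>) * ?n + ?m - ?n \<le> card (nbs (induced G S) v)" by linarith
      have "(1 / real r + \<epsilon>) * ?n \<le> (1 / q - \<epsilon>) * ?m"
      proof -
        \<comment> \<open>The identity (r - 1)/r = 1 - 1/r explains the threshold for |R|; the terms
          in \<epsilon> add up to at most 3\<delta>/8.\<close>
        have "(q * (1 / real r + \<epsilon> + \<epsilon>)) \<le> 1 - 1 / real r + \<delta> - \<epsilon>"
        proof -
          have "q * (1 / real r) = 1 - 1 / real r" using q by (simp add: field_simps)
          then show ?thesis using \<epsilon> \<epsilon>\<delta> by (simp add: algebra_simps)
        qed
        then have "(q * (1 / real r + \<epsilon> + \<epsilon>)) * ?n \<le> ?m"
          using mult_right_mono[of _ _ ?n] m by (meson of_nat_0_le_iff order_trans)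
        then have "(1 / real r + \<epsilon> + \<epsilon>) * ?n \<le> ?m / q" using q by (simp add: field_simps)
        moreover have "\<epsilon> * ?m \<le> \<epsilon> * ?n" using mn \<epsilon> by simp
        ultimately show ?thesis by (simp add: algebra_simps)
      qed
      then show "(1 - 1 / real (r - 1) + \<epsilon>) * card (verts (induced G S)) \<le> card (nbs (induced G S) v)"
        using d unfolding q' by (simp add: algebra_simps)
    qed
    then show "has_blowup (induced G (R - L)) r t" using r by (simp add: S_def)
  qed (use \<epsilon> in simp)
qed

subsection \<open>Vertices with a common neighbourhood\<close>

lemma sum_card_swap:
  assumes "finite A" "finite B"
  shows "(\<Sum>a\<in>A. card {b \<in> B. R a b}) = (\<Sum>b\<in>B. card {a \<in> A. R a b})"
  using sum.swap_restrict[OF assms, of "\<lambda>_ _. 1 :: nat" R] by simp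

text \<open>Fix a copy of K_r(T) made of vertices of nearly full degree. Without K_(r+1)(k), all but
  boundedly many vertices see fewer than \<open>k\<close> vertices of some part. Sorting them by
  such a part, one class has at most n/r vertices. The vertices of the other classes see almost all
  of the part belonging to it, and averaging picks \<open>k\<close> of its vertices with a large
  common neighbourhood.\<close>

lemma large_common_neighbourhood:
  fixes \<epsilon> :: real
  assumes r: "2 \<le> r" and \<epsilon>: "0 < \<epsilon>"
  shows "\<exists>\<eta>>0 :: real. \<exists>N. \<forall>G :: 'a graph. sgraph G \<longrightarrow> N \<le> card (verts G) \<longrightarrow>
     (1 - 1 / real r - \<eta>) * real (card (verts G)) ^ 2 / 2 \<le> card (edges G) \<longrightarrow> \<not> has_blowup G (Suc r) k \<longrightarrow>
     (\<exists>S W. S \<subseteq> verts G \<and> card S = k \<and> W \<subseteq> verts G \<and>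
        (1 - 1 / real r - \<epsilon>) * card (verts G) \<le> card W \<and> (\<forall>s\<in>S. W \<subseteq> nbs G s))"
proof -
  define p where "p = 1 - 1 / real r"
  \<comment> \<open>\<open>D\<close> collects the losses in units of \<beta>n: one for the
    exceptional set \<open>U\<close>, and 2(r + 2) for each of the \<open>k\<close> vertices of
    \<open>S\<close>.\<close>
  define D where "D = 1 + 2 * real k * (real r + 2)"
  have D: "1 \<le> D" by (simp add: D_def)
  define \<beta> where "\<beta> = min (1 / 4) (\<epsilon> / D)"
  have "\<beta> \<le> 1 / 4" "\<beta> \<le> \<epsilon> / D"
    unfolding \<beta>_def by (rule min.cobounded1, rule min.cobounded2)
  moreover have "0 < \<beta>" using \<epsilon> D by (simp add: \<beta>_def)
  ultimately have \<beta>: "0 < \<beta>" "\<beta> \<le> 1 / 4" "\<beta> \<le> \<epsilon> / D" by blast+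
  have \<beta>D: "\<beta> * D \<le> \<epsilon>" using \<beta>(3) D by (simp add: field_simps)
  \<comment> \<open>With k \<le> \<beta>T, the few neighbours in a poorly seen part are negligible;
    with 2k \<le> T, half of a part still contains \<open>k\<close> vertices.\<close>
  obtain T :: nat where "real k / \<beta> + 1 < real T" using reals_Archimedean2 by blast
  then have "real k / \<beta> \<le> real T" by linarith
  then have kT: "real k \<le> \<beta> * T" using \<beta> by (simp add: field_simps)
  have "\<beta> * T \<le> 1 / 4 * T" using \<beta> by (intro mult_right_mono) auto
  then have kT2: "2 * k \<le> T" using kT by linarith
  \<comment> \<open>For \<delta> = 1/r the required size of \<open>R\<close> is n, so the blowup is
    found in the whole vertex set minus the low-degree vertices.\<close>
  obtain \<epsilon>0 :: real and N0 where \<epsilon>0: "0 < \<epsilon>0" and N0: "\<forall>(G :: 'a graph) L R. sgraph G \<longrightarrow> N0 \<le> card (verts G) \<longrightarrow>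
     R \<subseteq> verts G \<longrightarrow> real (card L) \<le> \<epsilon>0 * card (verts G) \<longrightarrow> finite L \<longrightarrow>
     (\<forall>v\<in>verts G - L. (1 - 1 / real r - \<epsilon>0) * card (verts G) \<le> card (nbs G v)) \<longrightarrow>
     (1 - 1 / real r + 1 / real r) * card (verts G) \<le> card R \<longrightarrow> has_blowup (induced G (R - L)) r T"
    using blowup_in_large_set[OF r, of "1 / real r" T] r by fastforce
  define \<epsilon>1 where "\<epsilon>1 = min \<beta> \<epsilon>0"
  have \<epsilon>1: "0 < \<epsilon>1" "\<epsilon>1 \<le> 1 / 2" "\<epsilon>1 \<le> \<beta>" "\<epsilon>1 \<le> \<epsilon>0" using \<beta> \<epsilon>0 by (auto simp: \<epsilon>1_def)
  have "1 \<le> r" using r by simp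
  from few_low_degree_vertices[OF this \<epsilon>1(1,2), of k] obtain \<eta> N1 where \<eta>: "0 < \<eta>" and
    N1: "\<forall>G :: 'a graph. sgraph G \<longrightarrow> N1 \<le> card (verts G) \<longrightarrow>
     (1 - 1 / real r - \<eta>) * real (card (verts G)) ^ 2 / 2 \<le> card (edges G) \<longrightarrow> \<not> has_blowup G (Suc r) k \<longrightarrow>
     card {v \<in> verts G. card (nbs G v) < (1 - 1 / real r - \<epsilon>1) * card (verts G)} \<le> \<epsilon>1 * card (verts G)"
    by blast
  obtain N2 :: nat where N2: "real (k * 2 ^ (r * T)) / \<beta> < real N2" using reals_Archimedean2 by blast
  show ?thesis
  proof (rule exI[of _ \<eta>], intro conjI exI[of _ "max 1 (max N0 (max N1 N2))"] allI impI)
    fix G :: "'a graph"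
    let ?n = "real (card (verts G))"
    assume G: "sgraph G" and n: "max 1 (max N0 (max N1 N2)) \<le> card (verts G)"
      and e: "(1 - 1 / real r - \<eta>) * ?n ^ 2 / 2 \<le> card (edges G)" and free: "\<not> has_blowup G (Suc r) k"
    define L where "L = {v \<in> verts G. card (nbs G v) < (1 - 1 / real r - \<epsilon>1) * ?n}"
    have finV: "finite (verts G)" using G by (simp add: sgraph_def)
    have n0: "0 < ?n" using n by simp
    have finL: "finite L" using finV by (simp add: L_def)
    have "card L \<le> \<epsilon>1 * ?n" unfolding L_def using N1[rule_format, OF G _ e free] n by simp
    also have "\<dots> \<le> \<epsilon>0 * ?n" using \<epsilon>1 by (intro mult_right_mono) auto
    finally have cL: "real (card L) \<le> \<epsilon>0 * ?n" .
    have degL: "(p - \<epsilon>') * ?n \<le> card (nbs G v)" if "v \<in> verts G - L" "\<epsilon>1 \<le> \<epsilon>'" for v \<epsilon>'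
    proof -
      have "(p - \<epsilon>') * ?n \<le> (p - \<epsilon>1) * ?n" using that by (intro mult_right_mono) auto
      then show ?thesis using that by (auto simp: L_def p_def)
    qed
    have "has_blowup (induced G (verts G - L)) r T"
    proof (rule N0[rule_format, OF G _ order_refl cL finL])
      show "(1 - 1 / real r - \<epsilon>0) * ?n \<le> card (nbs G v)" if "v \<in> verts G - L" for v
        using degL[OF that \<epsilon>1(4)] by (simp add: p_def)
    qed (use n in auto)
    then obtain P where parts': "blowup_parts (induced G (verts G - L)) r T P"
      unfolding has_blowup_def by blast
    then have parts: "blowup_parts G r T P" by (rule blowup_parts_induced[rotated]) auto
    have P: "P i \<subseteq> verts G - L" "card (P i) = T" if "i < r" for i
      using parts' that by (auto simp: blowup_parts_def)
    have finP: "finite (P i)" if "i < r" for i using P[OF that] finV by (meson finite_Diff finite_subset)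
    define c where "c x i = real (card (nbs G x \<inter> P i))" for x i
    have le_T: "c x i \<le> T" if "i < r" for x i
      using card_mono[of "P i" "nbs G x \<inter> P i"] finP[OF that] P[OF that] by (simp add: c_def)
    define U where "U = {x \<in> verts G. \<forall>i<r. k \<le> card (nbs G x \<inter> P i)}"
    have finU: "finite U" using finV by (simp add: U_def)
    have "card U \<le> k * 2 ^ (r * T)"
      using has_blowup_extend[OF G parts, of k] free unfolding U_def by (meson not_le)
    then have "card U \<le> real (k * 2 ^ (r * T))" by (simp only: of_nat_le_iff)
    also have "\<dots> \<le> \<beta> * N2" using N2 \<beta> by (simp add: field_simps)
    also have "\<dots> \<le> \<beta> * ?n" using n \<beta> by (intro mult_left_mono) auto
    finally have cU: "card U \<le> \<beta> * ?n" .
    have "\<forall>x\<in>verts G - U. \<exists>i<r. c x i \<le> k"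
    proof
      fix x assume "x \<in> verts G - U"
      then obtain i where "i < r" "\<not> k \<le> card (nbs G x \<inter> P i)" by (auto simp: U_def)
      then show "\<exists>i<r. c x i \<le> k" by (intro exI[of _ i]) (simp add: c_def)
    qed
    \<comment> \<open>\<open>f\<close> assigns to each vertex outside \<open>U\<close> a part of
      which it sees at most \<open>k\<close> vertices; \<open>X\<close> lists the classes, and
      \<open>j\<close> is the index of one that is not above average.\<close>
    then obtain f where f: "\<And>x. x \<in> verts G - U \<Longrightarrow> f x < r \<and> c x (f x) \<le> k" by metis
    define X where "X i = {x \<in> verts G - U. f x = i}" for i
    have "\<exists>i<r. real r * card (X i) \<le> ?n"
    proof (rule ccontr)
      assume "\<not> ?thesis"
      then have "(\<Sum>i<r. ?n) < (\<Sum>i<r. real r * card (X i))"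
        using r by (intro sum_strict_mono) (auto simp: not_le lessThan_empty_iff)
      also have "\<dots> = real r * (\<Sum>i<r. card (X i))" by (simp add: sum_distrib_left)
      also have "(\<Sum>i<r. card (X i)) = card (\<Union>i<r. X i)"
        using finV by (intro card_UN_disjoint[symmetric]) (auto simp: X_def)
      also have "real r * card (\<Union>i<r. X i) \<le> real r * ?n"
        using finV by (intro mult_left_mono of_nat_mono card_mono) (auto simp: X_def)
      finally show False by simp
    qed
    then obtain j where j: "j < r" and Xj: "real r * card (X j) \<le> ?n" by blast
    txt \<open>
      Apart from \<open>U\<close>, every vertex misses almost all of some part. The degree sum over the parts leaves
      almost no room for further non-neighbours, so the vertices of \<open>W0\<close> see almost all of \<open>P j\<close>.
    \<close>
    define W0 where "W0 = {x \<in> verts G - U. f x \<noteq> j}"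
    have finW0: "finite W0" using finV by (simp add: W0_def)
    have "card (verts G) \<le> card (W0 \<union> U \<union> X j)"
      using finW0 finU finV by (intro card_mono) (auto simp: W0_def X_def)
    also have "\<dots> \<le> card W0 + card U + card (X j)"
      using card_Un_le[of "W0 \<union> U" "X j"] card_Un_le[of W0 U] by linarith
    finally have "?n \<le> card W0 + card U + card (X j)" by linarith
    moreover have "card (X j) \<le> ?n / r" using Xj r by (simp add: field_simps)
    ultimately have cW0: "(p - \<beta>) * ?n \<le> card W0" using cU by (simp add: p_def algebra_simps)
    \<comment> \<open>A vertex of \<open>W0\<close> is poor in the part \<open>f x\<close>, and its
      non-neighbours in the different part \<open>P j\<close> are subtracted as well. These
      subtracted terms are what the degree sum will bound.\<close>
    have bound: "(\<Sum>i<r. c x i) \<le> (real r - 1) * T + k + (if x \<in> U then real T else 0)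
        - (if x \<in> W0 then T - c x j else 0)" if x: "x \<in> verts G" for x
    proof (cases "x \<in> U")
      case True
      have "(\<Sum>i<r. c x i) \<le> (\<Sum>i<r. real T)" using le_T by (intro sum_mono) simp
      then show ?thesis using True by (simp add: W0_def algebra_simps)
    next
      case False
      then have fx: "f x < r" "c x (f x) \<le> k" using f x by auto
      have 1: "(\<Sum>i<r. c x i) = c x (f x) + (\<Sum>i\<in>{..<r}-{f x}. c x i)"
        using fx by (intro sum.remove) auto
      show ?thesis
      proof (cases "f x = j")
        case True
        have "(\<Sum>i\<in>{..<r}-{f x}. c x i) \<le> (\<Sum>i\<in>{..<r}-{f x}. real T)"
          using le_T by (intro sum_mono) auto
        also have "\<dots> = (real r - 1) * T" using fx r by (simp add: of_nat_diff)
        finally show ?thesis using True False fx 1 by (simp add: W0_def)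
      next
        case neq: False
        have "(\<Sum>i\<in>{..<r}-{f x}. c x i) = c x j + (\<Sum>i\<in>{..<r}-{f x}-{j}. c x i)"
          using neq j by (intro sum.remove) auto
        also have "(\<Sum>i\<in>{..<r}-{f x}-{j}. c x i) \<le> (\<Sum>i\<in>{..<r}-{f x}-{j}. real T)"
          using le_T by (intro sum_mono) auto
        also have "\<dots> = (real r - 2) * T" using fx r j neq by (simp add: of_nat_diff)
        finally show ?thesis using False neq fx 1 x by (simp add: W0_def algebra_simps)
      qed
    qed
    have "real r * (T * ((p - \<beta>) * ?n)) = (\<Sum>i<r. \<Sum>v\<in>P i. (p - \<beta>) * ?n)"
      using P by simp
    also have "\<dots> \<le> (\<Sum>i<r. \<Sum>v\<in>P i. real (card (nbs G v)))"
      using P degL[OF _ \<epsilon>1(3)] by (intro sum_mono) blast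
    also have "\<dots> = (\<Sum>i<r. \<Sum>x\<in>verts G. c x i)"
    proof (rule sum.cong[OF refl])
      fix i assume "i \<in> {..<r}"
      then have "(\<Sum>v\<in>P i. card (nbs G v)) = (\<Sum>x\<in>verts G. card (nbs G x \<inter> P i))"
        using P by (intro sum_degrees_eq[OF G]) auto
      then show "(\<Sum>v\<in>P i. real (card (nbs G v))) = (\<Sum>x\<in>verts G. c x i)"
        unfolding c_def by (metis of_nat_sum)
    qed
    also have "\<dots> = (\<Sum>x\<in>verts G. \<Sum>i<r. c x i)"
      by (rule sum.swap)
    also have "\<dots> \<le> (\<Sum>x\<in>verts G. (real r - 1) * T + k + (if x \<in> U then real T else 0)
        - (if x \<in> W0 then T - c x j else 0))"
      by (rule sum_mono) (rule bound)
    also have "\<dots> = ?n * ((real r - 1) * T + k) + card U * T - (\<Sum>x\<in>W0. T - c x j)"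
    proof -
      have "verts G \<inter> {x. x \<in> U} = U" "verts G \<inter> {x. x \<in> W0} = W0" by (auto simp: U_def W0_def)
      then show ?thesis using finV by (simp add: sum.distrib sum_subtractf sum.If_cases)
    qed
    finally have "(\<Sum>x\<in>W0. T - c x j) \<le>
        ?n * ((real r - 1) * T + k) + card U * T - real r * (T * ((p - \<beta>) * ?n))" by linarith
    also have "\<dots> = ?n * k + card U * T + real r * (T * (\<beta> * ?n))"
      using r by (simp add: p_def field_simps)
    also have "\<dots> \<le> ?n * (\<beta> * T) + (\<beta> * ?n) * T + real r * (T * (\<beta> * ?n))"
      using mult_left_mono[OF kT, of ?n] mult_right_mono[OF cU, of T] by (simp add: algebra_simps)
    also have "\<dots> = T * ((real r + 2) * \<beta> * ?n)" by (simp add: algebra_simps)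
    finally have miss: "(\<Sum>x\<in>W0. T - c x j) \<le> T * ((real r + 2) * \<beta> * ?n)" .
    define \<gamma> where "\<gamma> = (real r + 2) * \<beta>"
    have \<gamma>: "0 < \<gamma>" using \<beta> by (simp add: \<gamma>_def)
    have "(\<Sum>s\<in>P j. card (W0 - nbs G s)) = (\<Sum>x\<in>W0. card (P j - nbs G x))"
    proof -
      have a: "W0 - nbs G s = {x \<in> W0. s \<notin> nbs G x}" for s
        using mem_nbs_sym[OF G] by blast
      have b: "P j - nbs G x = {s \<in> P j. s \<notin> nbs G x}" for x by blast
      show ?thesis unfolding a b by (rule sum_card_swap[OF finP[OF j] finW0])
    qed
    then have "(\<Sum>s\<in>P j. real (card (W0 - nbs G s))) = (\<Sum>x\<in>W0. real (card (P j - nbs G x)))"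
      by (metis of_nat_sum)
    also have "\<dots> = (\<Sum>x\<in>W0. T - c x j)"
    proof (rule sum.cong[OF refl])
      fix x
      have "card (P j - nbs G x) = card (P j) - card (nbs G x \<inter> P j)"
        using finP[OF j] by (simp add: card_Diff_subset_Int Int_commute)
      then show "real (card (P j - nbs G x)) = T - c x j"
        using P(2)[OF j] le_T[OF j, of x] by (simp add: c_def of_nat_diff)
    qed
    finally have sumP: "(\<Sum>s\<in>P j. real (card (W0 - nbs G s))) \<le> T * (\<gamma> * ?n)"
      using miss by (simp add: \<gamma>_def)
    \<comment> \<open>Markov's inequality: the average over \<open>P j\<close> of the number of
      missed vertices of \<open>W0\<close> is at most \<gamma>n, so at most half of
      \<open>P j\<close> exceeds twice that.\<close>
    define B where "B = {s \<in> P j. 2 * \<gamma> * ?n < card (W0 - nbs G s)}"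
    have BP: "B \<subseteq> P j" by (auto simp: B_def)
    have "card B * (2 * \<gamma> * ?n) = (\<Sum>s\<in>B. 2 * \<gamma> * ?n)" by simp
    also have "\<dots> \<le> (\<Sum>s\<in>B. real (card (W0 - nbs G s)))" by (intro sum_mono) (auto simp: B_def)
    also have "\<dots> \<le> (\<Sum>s\<in>P j. real (card (W0 - nbs G s)))"
      using finP[OF j] BP by (intro sum_mono2) auto
    finally have "(2 * real (card B)) * (\<gamma> * ?n) \<le> T * (\<gamma> * ?n)" using sumP by (simp add: algebra_simps)
    then have "2 * real (card B) \<le> T" using \<gamma> n0 by simp
    then have "k \<le> card (P j - B)"
      using kT2 P(2)[OF j] card_Diff_subset[OF finite_subset[OF BP finP[OF j]] BP] by linarith
    then obtain S where S: "S \<subseteq> P j - B" "card S = k" by (meson obtain_subset_with_card_n)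
    have finS: "finite S" using S finP[OF j] by (meson finite_Diff finite_subset)
    define W where "W = {x \<in> W0. \<forall>s\<in>S. x \<in> nbs G s}"
    have "card (\<Union>s\<in>S. W0 - nbs G s) \<le> (\<Sum>s\<in>S. card (W0 - nbs G s))"
      using finS by (rule card_UN_le)
    then have "real (card (\<Union>s\<in>S. W0 - nbs G s)) \<le> (\<Sum>s\<in>S. real (card (W0 - nbs G s)))"
      by (metis of_nat_le_iff of_nat_sum)
    also have "\<dots> \<le> (\<Sum>s\<in>S. 2 * \<gamma> * ?n)" using S by (intro sum_mono) (auto simp: B_def not_less)
    finally have "real (card (\<Union>s\<in>S. W0 - nbs G s)) \<le> k * (2 * \<gamma> * ?n)" using S by simp
    moreover have "card W0 \<le> card W + card (\<Union>s\<in>S. W0 - nbs G s)"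
    proof -
      have "card W0 \<le> card (W \<union> (\<Union>s\<in>S. W0 - nbs G s))"
        using finW0 finS by (intro card_mono) (auto simp: W_def)
      then show ?thesis using card_Un_le order_trans by blast
    qed
    ultimately have "card W0 - k * (2 * \<gamma> * ?n) \<le> card W" by linarith
    moreover have "(p - \<epsilon>) * ?n \<le> (p - \<beta>) * ?n - k * (2 * \<gamma> * ?n)"
    proof -
      have "(\<beta> * D) * ?n \<le> \<epsilon> * ?n" using \<beta>D by (rule mult_right_mono) simp
      then show ?thesis by (simp add: D_def \<gamma>_def algebra_simps)
    qed
    ultimately have "(1 - 1 / real r - \<epsilon>) * ?n \<le> card W" using cW0 unfolding p_def by linarith
    moreover have "S \<subseteq> verts G" using S P[OF j] by blast
    moreover have "W \<subseteq> verts G" by (auto simp: W_def W0_def)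
    moreover have "\<forall>s\<in>S. W \<subseteq> nbs G s" by (auto simp: W_def)
    ultimately show "\<exists>S W. S \<subseteq> verts G \<and> card S = k \<and> W \<subseteq> verts G \<and>
        (1 - 1 / real r - \<epsilon>) * ?n \<le> card W \<and> (\<forall>s\<in>S. W \<subseteq> nbs G s)"
      using S(2) by blast
  qed (use \<eta> in simp)
qed

subsection \<open>Embeddings and colourings\<close>

lemma free_of_iff:
  assumes "sgraph F"
  shows "free_of F G \<longleftrightarrow> (\<nexists>f. embeds_via f F G)"
proof -
  have "(\<exists>H. subgraph H G \<and> isomorphic F H) \<longleftrightarrow> (\<exists>f. embeds_via f F G)"
  proof
    assume "\<exists>H. subgraph H G \<and> isomorphic F H"
    then obtain H f where "subgraph H G" "bij_betw f (verts F) (verts H)"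
      "edges H = (\<lambda>e. f ` e) ` edges F" unfolding isomorphic_def by blast
    then have "embeds_via f F G"
      unfolding embeds_via_def subgraph_def bij_betw_def by blast
    then show "\<exists>f. embeds_via f F G" by blast
  next
    assume "\<exists>f. embeds_via f F G"
    then obtain f where f: "inj_on f (verts F)" "f ` verts F \<subseteq> verts G" "\<forall>e\<in>edges F. f ` e \<in> edges G"
      unfolding embeds_via_def by blast
    let ?H = "(f ` verts F, (\<lambda>e. f ` e) ` edges F)"
    have "sgraph ?H" unfolding sgraph_def
    proof (intro conjI ballI)
      show "finite (verts ?H)" using assms by (simp add: sgraph_def)
      fix e' assume "e' \<in> edges ?H"
      then obtain e where e: "e \<in> edges F" "e' = f ` e" by auto
      then have "e \<subseteq> verts F" "card e = 2" using assms by (auto simp: sgraph_def)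
      then show "e' \<subseteq> verts ?H" "card e' = 2"
        using e f(1) card_image[of f e] by (auto intro: inj_on_subset)
    qed
    then have "subgraph ?H G" using f by (auto simp: subgraph_def)
    moreover have "isomorphic F ?H" using f(1) by (auto simp: isomorphic_def bij_betw_def)
    ultimately show "\<exists>H. subgraph H G \<and> isomorphic F H" by blast
  qed
  then show ?thesis by (simp add: free_of_def)
qed

lemma embeds_via_induced: "S \<subseteq> verts G \<Longrightarrow> embeds_via f F (induced G S) \<Longrightarrow> embeds_via f F G"
  by (auto simp: embeds_via_def)

text \<open>The \<open>LEAST\<close> in \<open>chromatic_number\<close> is attained because
  numbering the vertices of a finite graph is a proper colouring.\<close>

lemma chromatic_number_coloring:
  assumes "sgraph G" shows "\<exists>c. proper_coloring G (chromatic_number G) c"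
proof -
  obtain c :: "'a \<Rightarrow> nat" and n where "inj_on c (verts G)" "c ` verts G = {i. i < n}"
    using finite_imp_inj_to_nat_seg[of "verts G"] assms by (metis sgraph_def)
  moreover have "c u \<noteq> c v" if "{u, v} \<in> edges G" "inj_on c (verts G)" for u v
  proof -
    have "u \<noteq> v" using sgraph_no_loop[OF assms] that(1) by metis
    moreover have "u \<in> verts G" "v \<in> verts G" using assms that(1) by (auto simp: sgraph_def)
    ultimately show ?thesis using that(2) by (meson inj_onD)
  qed
  ultimately have "proper_coloring G n c" by (auto simp: proper_coloring_def)
  then show ?thesis
    unfolding chromatic_number_def using LeastI[of "\<lambda>k. \<exists>c. proper_coloring G k c" n] by blast
qed

lemma chromatic_number_le: "proper_coloring G k c \<Longrightarrow> chromatic_number G \<le> k"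
  unfolding chromatic_number_def by (rule Least_le) (rule exI)

text \<open>Each colour class goes into its own part, which has room for all of \<open>F\<close>.
  Vertices of different colours have adjacent, hence distinct, images.\<close>

lemma embed_in_blowup:
  assumes F: "sgraph F" and G: "sgraph G" and c: "proper_coloring F r c"
    and k: "card (verts F) \<le> t" and bl: "has_blowup G r t"
  shows "\<exists>f. embeds_via f F G"
proof -
  obtain P where P: "blowup_parts G r t P" using bl unfolding has_blowup_def by blast
  have finF: "finite (verts F)" using F by (simp add: sgraph_def)
  have "\<exists>g. g ` verts F \<subseteq> P i \<and> inj_on g (verts F)" if "i < r" for i
  proof (rule card_le_inj[OF finF])
    show "finite (P i)" using P that G by (auto simp: blowup_parts_def sgraph_def intro: finite_subset)
    show "card (verts F) \<le> card (P i)" using P that k by (simp add: blowup_parts_def)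
  qed
  then obtain g where g: "\<And>i. i < r \<Longrightarrow> g i ` verts F \<subseteq> P i \<and> inj_on (g i) (verts F)" by metis
  have cr: "c x < r" if "x \<in> verts F" for x using c that by (auto simp: proper_coloring_def)
  define f where "f x = g (c x) x" for x
  have fP: "f x \<in> P (c x)" if "x \<in> verts F" for x using g[OF cr[OF that]] that by (auto simp: f_def)
  have adj: "{f x, f y} \<in> edges G" if "x \<in> verts F" "y \<in> verts F" "c x \<noteq> c y" for x y
    using P cr[OF that(1)] cr[OF that(2)] that(3) fP[OF that(1)] fP[OF that(2)]
    unfolding blowup_parts_def by blast
  have "embeds_via f F G" unfolding embeds_via_def
  proof (intro conjI ballI)
    show "inj_on f (verts F)"
    proof (rule inj_onI)
      fix x y assume xy: "x \<in> verts F" "y \<in> verts F" "f x = f y"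
      then have "c x = c y" using adj[OF xy(1,2)] sgraph_no_loop[OF G] by metis
      then show "x = y" using g[OF cr[OF xy(1)]] xy by (auto simp: f_def dest: inj_onD)
    qed
    show "f ` verts F \<subseteq> verts G" using fP cr P by (fastforce simp: blowup_parts_def)
    fix e assume e: "e \<in> edges F"
    then obtain x y where xy: "e = {x, y}" "x \<in> verts F" "y \<in> verts F" using sgraph_edgeE[OF F] by metis
    then have "c x \<noteq> c y" using c e by (simp add: proper_coloring_def)
    then show "f ` e \<in> edges G" using adj xy by simp
  qed
  then show ?thesis by blast
qed

lemma sgraph_del_vert: "sgraph F \<Longrightarrow> sgraph (del_vert F u)"
  by (auto simp: sgraph_def del_vert_def)

text \<open>\<open>v\<close> takes the role of \<open>u\<close>: it is adjacent to all of
  \<open>S\<close>, where the neighbours of \<open>u\<close> are placed. This is how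
  vertex-criticality is exploited, since \<open>F\<close> minus a critical vertex needs one colour
  less.\<close>

lemma embed_through_vertex:
  assumes F: "sgraph F" and G: "sgraph G" and u: "u \<in> verts F" and v: "v \<in> verts G"
    and S: "S \<subseteq> nbs G v" and f: "embeds_via f (del_vert F u) (induced G S)"
  shows "embeds_via (f(u := v)) F (induced G (insert v S))"
proof -
  have vS: "v \<notin> S" using S sgraph_no_loop[OF G] by (auto simp: nbs_def)
  have fS: "f ` (verts F - {u}) \<subseteq> S" and inj: "inj_on f (verts F - {u})"
    using f by (auto simp: embeds_via_def del_vert_def)
  show ?thesis unfolding embeds_via_def
  proof (intro conjI ballI)
    show "inj_on (f(u := v)) (verts F)"
    proof (rule inj_onI)
      fix x y assume xy: "x \<in> verts F" "y \<in> verts F" "(f(u := v)) x = (f(u := v)) y"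
      have "f z \<noteq> v" if "z \<in> verts F" "z \<noteq> u" for z using that fS vS by blast
      then show "x = y" using xy inj_onD[OF inj, of x y] by (auto split: if_splits)
    qed
    show "(f(u := v)) ` verts F \<subseteq> verts (induced G (insert v S))" using fS by auto
    fix e assume e: "e \<in> edges F"
    show "(f(u := v)) ` e \<in> edges (induced G (insert v S))"
    proof (cases "u \<in> e")
      case False
      then have "f ` e \<in> edges (induced G S)" using f e by (auto simp: embeds_via_def del_vert_def)
      moreover have "(f(u := v)) ` e = f ` e" using False by auto
      ultimately show ?thesis by auto
    next
      case True
      obtain x y where "e = {x, y}" "x \<noteq> y" "x \<in> verts F" "y \<in> verts F"
        using sgraph_edgeE[OF F e] by metis
      then obtain z where z: "e = {u, z}" "z \<noteq> u" "z \<in> verts F" using True by (auto simp: insert_commute)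
      then have "f z \<in> S" using fS by blast
      then show ?thesis using z S by (auto simp: nbs_def insert_commute)
    qed
  qed
qed

section \<open>Disjoint copies of a graph\<close>

lemma verts_copies: "verts (copies m F) = {..<m} \<times> verts F"
  by (simp add: copies_def)

lemma edges_copies: "edges (copies m F) = {Pair i ` e | i e. i < m \<and> e \<in> edges F}"
  by (simp add: copies_def)

lemma sgraph_copies:
  assumes "sgraph F" shows "sgraph (copies m F)"
  unfolding sgraph_def
proof (intro conjI ballI)
  show "finite (verts (copies m F))" using assms by (simp add: verts_copies sgraph_def)
  fix e' assume "e' \<in> edges (copies m F)"
  then obtain i e where e: "e' = Pair i ` e" "i < m" "e \<in> edges F" unfolding edges_copies by blast
  then show "e' \<subseteq> verts (copies m F)" using assms by (auto simp: sgraph_def verts_copies)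
  have "card e' = card e" unfolding e(1) by (rule card_image) (simp add: inj_on_def)
  then show "card e' = 2" using assms e(3) by (simp add: sgraph_def)
qed

text \<open>All copies reuse the colours of \<open>F\<close>, so a complete multipartite graph with
  enough large parts contains \<open>copies m F\<close> as well.\<close>

lemma proper_coloring_copies:
  assumes "proper_coloring F r c"
  shows "proper_coloring (copies m F) r (\<lambda>p. c (snd p))"
  unfolding proper_coloring_def
proof (intro conjI allI impI)
  show "(\<lambda>p. c (snd p)) ` verts (copies m F) \<subseteq> {..<r}"
    using assms by (auto simp: proper_coloring_def verts_copies)
  fix p q assume "{p, q} \<in> edges (copies m F)"
  then obtain i e where e: "{p, q} = Pair i ` e" "e \<in> edges F" by (auto simp: edges_copies)
  have "{snd p, snd q} = snd ` Pair i ` e" unfolding e(1)[symmetric] by simp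
  also have "\<dots> = e" by (simp add: image_image)
  finally have "{snd p, snd q} \<in> edges F" using e(2) by simp
  then show "c (snd p) \<noteq> c (snd q)" using assms by (simp add: proper_coloring_def)
qed

lemma embeds_copies_mono:
  assumes "embeds_via f (copies m F) G" "l \<le> m" shows "embeds_via f (copies l F) G"
proof -
  have "verts (copies l F) \<subseteq> verts (copies m F)" "edges (copies l F) \<subseteq> edges (copies m F)"
    using assms(2) unfolding verts_copies edges_copies by fastforce+
  then show ?thesis using assms(1) unfolding embeds_via_def by (meson image_mono inj_on_subset order_trans subsetD)
qed

lemma embeds_copies_component:
  assumes "embeds_via f (copies m F) G" "i < m" shows "embeds_via (\<lambda>x. f (i, x)) F G"
  unfolding embeds_via_def
proof (intro conjI ballI)
  show "inj_on (\<lambda>x. f (i, x)) (verts F)"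
    using assms by (auto simp: embeds_via_def verts_copies inj_on_def)
  show "(\<lambda>x. f (i, x)) ` verts F \<subseteq> verts G"
    using assms by (auto simp: embeds_via_def verts_copies)
  fix e assume "e \<in> edges F"
  then have "Pair i ` e \<in> edges (copies m F)" using assms(2) by (auto simp: edges_copies)
  then have "f ` Pair i ` e \<in> edges G" using assms(1) by (simp add: embeds_via_def)
  then show "(\<lambda>x. f (i, x)) ` e \<in> edges G" by (simp add: image_image)
qed

lemma embeds_copies_Suc:
  assumes F: "sgraph F" and f: "embeds_via f (copies m F) G" and g: "embeds_via g F G"
    and dis: "f ` verts (copies m F) \<inter> g ` verts F = {}"
  shows "embeds_via (\<lambda>p. if fst p = m then g (snd p) else f p) (copies (Suc m) F) G"
  unfolding embeds_via_def
proof (intro conjI ballI)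
  let ?h = "\<lambda>p. if fst p = m then g (snd p) else f p"
  have old: "p \<in> verts (copies m F)" if "p \<in> verts (copies (Suc m) F)" "fst p \<noteq> m" for p
    using that by (auto simp: verts_copies)
  have new: "snd p \<in> verts F" if "p \<in> verts (copies (Suc m) F)" for p
    using that by (auto simp: verts_copies)
  show "inj_on ?h (verts (copies (Suc m) F))"
  proof (rule inj_onI)
    fix p q assume pq: "p \<in> verts (copies (Suc m) F)" "q \<in> verts (copies (Suc m) F)" "?h p = ?h q"
    have ne: "f a \<noteq> g (snd b)" if "a \<in> verts (copies (Suc m) F)" "fst a \<noteq> m"
      "b \<in> verts (copies (Suc m) F)" for a b
      using dis old[OF that(1,2)] new[OF that(3)] by blast
    consider "fst p = m" "fst q = m" | "fst p \<noteq> m" "fst q \<noteq> m"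
      | "fst p \<noteq> m" "fst q = m" | "fst p = m" "fst q \<noteq> m" by blast
    then show "p = q"
    proof cases
      case 1
      then have "snd p = snd q" using g pq new[OF pq(1)] new[OF pq(2)]
        by (auto simp: embeds_via_def dest: inj_onD)
      then show ?thesis using 1 by (simp add: prod_eq_iff)
    next
      case 2
      then show ?thesis using f pq old[OF pq(1)] old[OF pq(2)]
        by (auto simp: embeds_via_def dest: inj_onD)
    next
      case 3
      then show ?thesis using ne[OF pq(1) _ pq(2)] pq(3) by simp
    next
      case 4
      then show ?thesis using ne[OF pq(2) _ pq(1)] pq(3) by simp
    qed
  qed
  have "f ` verts (copies m F) \<subseteq> verts G" "g ` verts F \<subseteq> verts G"
    using f g by (auto simp: embeds_via_def)
  then show "?h ` verts (copies (Suc m) F) \<subseteq> verts G" using old new by (auto simp: image_subset_iff)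
  fix e assume "e \<in> edges (copies (Suc m) F)"
  then obtain i e' where e: "e = Pair i ` e'" "i < Suc m" "e' \<in> edges F" by (auto simp: edges_copies)
  show "?h ` e \<in> edges G"
  proof (cases "i = m")
    case True
    have "?h ` e = g ` e'" unfolding e(1) image_image True by simp
    then show ?thesis using g e by (simp add: embeds_via_def)
  next
    case False
    then have "i < m" using e(2) by simp
    then have "e \<in> edges (copies m F)" using e(1,3) unfolding edges_copies by blast
    moreover have "?h ` e = f ` e" unfolding e(1) image_image using False by simp
    ultimately show ?thesis using f by (simp add: embeds_via_def)
  qed
qed

section \<open>Adding one vertex\<close>

definition add_vertex :: "'a graph \<Rightarrow> 'a \<Rightarrow> 'a set \<Rightarrow> 'a graph" where
  "add_vertex G v W = (insert v (verts G), edges G \<union> (\<lambda>w. {v, w}) ` W)"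

lemma sgraph_add_vertex:
  assumes "sgraph G" "v \<notin> verts G" "W \<subseteq> verts G"
  shows "sgraph (add_vertex G v W)"
proof -
  have "card {v, w} = 2" if "w \<in> W" for w using assms that by (intro card_2_iff[THEN iffD2]) blast
  then show ?thesis using assms by (auto simp: sgraph_def add_vertex_def)
qed

lemma card_verts_add_vertex:
  "sgraph G \<Longrightarrow> v \<notin> verts G \<Longrightarrow> card (verts (add_vertex G v W)) = Suc (card (verts G))"
  by (simp add: add_vertex_def sgraph_def)

lemma card_edges_add_vertex:
  assumes "sgraph G" "v \<notin> verts G" "W \<subseteq> verts G"
  shows "card (edges (add_vertex G v W)) = card (edges G) + card W"
proof -
  have "edges G \<inter> (\<lambda>w. {v, w}) ` W = {}" using assms by (auto simp: sgraph_def)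
  moreover have "finite W" using assms by (auto simp: sgraph_def intro: finite_subset)
  moreover have "inj_on (\<lambda>w. {v, w}) W" by (auto simp: inj_on_def doubleton_eq_iff)
  ultimately show ?thesis using sgraph_finite_edges[OF assms(1)]
    by (simp add: add_vertex_def card_Un_disjoint card_image)
qed

text \<open>If the new vertex \<open>v\<close> occurs in a copy of \<open>F\<close>, some \<open>s \<in> S\<close> outside the copy can take its place.\<close>

lemma free_of_add_vertex:
  assumes F: "sgraph F" and G: "sgraph G" and free: "free_of F G" and v: "v \<notin> verts G"
    and S: "S \<subseteq> verts G" "card (verts F) \<le> card S" and W: "\<And>s. s \<in> S \<Longrightarrow> W \<subseteq> nbs G s"
  shows "free_of F (add_vertex G v W)"
  unfolding free_of_iff[OF F]
proof
  assume "\<exists>f. embeds_via f F (add_vertex G v W)"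
  then obtain f where inj: "inj_on f (verts F)" and fV: "f ` verts F \<subseteq> insert v (verts G)"
    and fE: "\<And>e. e \<in> edges F \<Longrightarrow> f ` e \<in> edges G \<union> (\<lambda>w. {v, w}) ` W"
    by (auto simp: embeds_via_def add_vertex_def)
  have finF: "finite (verts F)" using F by (simp add: sgraph_def)
  have notE: "e \<notin> edges G" if "v \<in> e" for e using G v that by (auto simp: sgraph_def)
  have "\<exists>g. embeds_via g F G"
  proof (cases "v \<in> f ` verts F")
    case False
    have "f ` e \<in> edges G" if "e \<in> edges F" for e
    proof -
      have "v \<notin> f ` e" using False F that unfolding sgraph_def by blast
      then show ?thesis using fE[OF that] by auto
    qed
    then have "embeds_via f F G" using inj fV False by (auto simp: embeds_via_def)
    then show ?thesis by blast
  next
    case True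
    then obtain u where u: "u \<in> verts F" "f u = v" by blast
    have "card (f ` (verts F - {u})) < card (verts F)"
      using u finF by (meson card_Diff1_less card_image_le finite_Diff le_less_trans)
    then have "\<not> S \<subseteq> f ` (verts F - {u})"
      using S(2) finF card_mono[of "f ` (verts F - {u})" S] by auto
    then obtain s where s: "s \<in> S" "s \<notin> f ` (verts F - {u})" by blast
    have fne: "f x \<noteq> v" if "x \<in> verts F" "x \<noteq> u" for x using that inj u by (auto dest: inj_onD)
    have "embeds_via (f(u := s)) F G" unfolding embeds_via_def
    proof (intro conjI ballI)
      show "inj_on (f(u := s)) (verts F)"
      proof (rule inj_onI)
        fix x y assume xy: "x \<in> verts F" "y \<in> verts F" "(f(u := s)) x = (f(u := s)) y"
        then show "x = y" using s inj_onD[OF inj, of x y] by (auto split: if_splits)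
      qed
      show "(f(u := s)) ` verts F \<subseteq> verts G" using fV fne s S by (auto simp: image_subset_iff)
      fix e assume e: "e \<in> edges F"
      show "(f(u := s)) ` e \<in> edges G"
      proof (cases "u \<in> e")
        case False
        have "e \<subseteq> verts F" using F e by (auto simp: sgraph_def)
        then have "v \<notin> f ` e" using False fne by blast
        then have "f ` e \<in> edges G" using fE[OF e] by auto
        moreover have "(f(u := s)) ` e = f ` e" using False by auto
        ultimately show ?thesis by simp
      next
        case True
        obtain x y where "e = {x, y}" "x \<noteq> y" "x \<in> verts F" "y \<in> verts F"
          using sgraph_edgeE[OF F e] by metis
        then obtain z where z: "e = {u, z}" "z \<noteq> u" "z \<in> verts F" using True by (auto simp: insert_commute)
        have "{v, f z} \<in> (\<lambda>w. {v, w}) ` W" using fE[OF e] z u notE[of "{v, f z}"] by auto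
        then have "f z \<in> W" by (auto simp: doubleton_eq_iff)
        then have "f z \<in> nbs G s" using W[OF s(1)] by blast
        then show ?thesis using z by (simp add: nbs_def insert_commute)
      qed
    qed
    then show ?thesis by blast
  qed
  then show False using free free_of_iff[OF F] by blast
qed

section \<open>Turan graphs\<close>

text \<open>The classes are the residues modulo \<open>r\<close>. Inserting the vertices one at a
  time lets \<open>card_edges_add_vertex\<close> count the edges by induction.\<close>

primrec turan :: "nat \<Rightarrow> nat \<Rightarrow> nat graph" where
  "turan r 0 = ({}, {})"
| "turan r (Suc n) = add_vertex (turan r n) n {x. x < n \<and> x mod r \<noteq> n mod r}"

lemma verts_turan: "verts (turan r n) = {..<n}"
  by (induction n) (simp_all only: turan.simps add_vertex_def lessThan_Suc lessThan_0 fst_conv)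

lemma sgraph_turan: "sgraph (turan r n)"
proof (induction n)
  case 0
  then show ?case by (simp add: sgraph_def)
next
  case (Suc n)
  then show ?case by (auto intro!: sgraph_add_vertex simp: verts_turan)
qed

lemma turan_edge_mod: "{x, y} \<in> edges (turan r n) \<Longrightarrow> x mod r \<noteq> y mod r"
proof (induction n)
  case (Suc n)
  show ?case
  proof (cases "{x, y} \<in> edges (turan r n)")
    case False
    then obtain w where "{x, y} = {n, w}" "w mod r \<noteq> n mod r"
      using Suc.prems unfolding turan.simps add_vertex_def snd_conv by blast
    then show ?thesis unfolding doubleton_eq_iff by metis
  qed (rule Suc.IH)
qed simp

text \<open>The new vertex n has at most n/r + 1 earlier vertices in its class, so it gains at least
  pn - 1 edges. The linear error is harmless, as only the density is used.\<close>

lemma card_edges_turan: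
  assumes "1 \<le> r"
  shows "(1 - 1 / real r) * real n ^ 2 / 2 - 2 * real n \<le> card (edges (turan r n))"
proof -
  define p where "p = 1 - 1 / real r"
  have "p * (real n * (real n - 1)) / 2 - n \<le> card (edges (turan r n))"
  proof (induction n)
    case 0
    then show ?case by simp
  next
    case (Suc n)
    let ?A = "{x. x < n \<and> x mod r = n mod r}" and ?B = "{x. x < n \<and> x mod r \<noteq> n mod r}"
    \<comment> \<open>Numbers with equal residue are told apart by their quotients, and these are at
      most \<open>n div r\<close>.\<close>
    have inj: "inj_on (\<lambda>x. x div r) ?A"
    proof (rule inj_onI)
      fix x y assume xy: "x \<in> ?A" "y \<in> ?A" "x div r = y div r"
      have "x = x div r * r + x mod r" by (rule div_mult_mod_eq[symmetric])
      also have "x mod r = n mod r" using xy(1) by blast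
      also have "n mod r = y mod r" using xy(2) by (metis (mono_tags, lifting) mem_Collect_eq)
      also have "x div r * r + y mod r = y" unfolding xy(3) by (rule div_mult_mod_eq)
      finally show "x = y" .
    qed
    have "card ?A = card ((\<lambda>x. x div r) ` ?A)" by (rule card_image[OF inj, symmetric])
    also have "\<dots> \<le> card {..n div r}"
      by (rule card_mono[OF finite_atMost]) (auto intro: div_le_mono)
    finally have "card ?A \<le> n div r + 1" by (simp only: card_atMost Suc_eq_plus1)
    moreover have "real (n div r) \<le> n / r" by (rule of_nat_div_le_of_nat)
    ultimately have A: "card ?A \<le> n / r + 1" by linarith
    have un: "?A \<union> ?B = {..<n}" by blast
    have "finite ?A" "finite ?B" by (rule finite_subset[of _ "{..<n}"]; blast)+
    moreover have "?A \<inter> ?B = {}" by blast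
    ultimately have "card (?A \<union> ?B) = card ?A + card ?B" by (rule card_Un_disjoint)
    with un have "n = card ?A + card ?B" by (metis card_lessThan)
    moreover have "p * n = n - n / r" by (simp add: p_def algebra_simps)
    ultimately have "p * n - 1 \<le> card ?B" using A by linarith
    moreover have "card (edges (turan r (Suc n))) = card (edges (turan r n)) + card ?B"
      unfolding turan.simps
    proof (rule card_edges_add_vertex[OF sgraph_turan])
      show "?B \<subseteq> verts (turan r n)" unfolding verts_turan by blast
    qed (simp add: verts_turan)
    moreover have "p * (real (Suc n) * (real (Suc n) - 1)) / 2 = p * (real n * (real n - 1)) / 2 + p * n"
      by (simp add: algebra_simps add_divide_distrib diff_divide_distrib)
    ultimately show ?case using Suc.IH by linarith
  qed
  moreover have "p * real n \<le> n" using mult_right_mono[of p 1 "real n"] by (simp add: p_def)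
  moreover have "p * (real n * (real n - 1)) = p * real n ^ 2 - p * n"
    by (simp only: power2_eq_square right_diff_distrib mult_1_right)
  ultimately show ?thesis unfolding p_def[symmetric] by linarith
qed

text \<open>Taking residues of an embedding would colour \<open>F\<close> with \<open>r\<close>
  colours.\<close>

lemma free_of_turan:
  assumes F: "sgraph F" and r: "1 \<le> r" "r < chromatic_number F"
  shows "free_of F (turan r n)"
  unfolding free_of_iff[OF F]
proof
  assume "\<exists>f. embeds_via f F (turan r n)"
  then obtain f where f: "embeds_via f F (turan r n)" by blast
  have "proper_coloring F r (\<lambda>x. f x mod r)" unfolding proper_coloring_def
  proof (intro conjI allI impI)
    show "(\<lambda>x. f x mod r) ` verts F \<subseteq> {..<r}" using r by auto
    fix u v assume "{u, v} \<in> edges F"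
    then have "{f u, f v} \<in> edges (turan r n)" using f by (fastforce simp: embeds_via_def)
    then show "f u mod r \<noteq> f v mod r" by (rule turan_edge_mod)
  qed
  then show False using chromatic_number_le r by fastforce
qed

subsection \<open>Growth of the extremal number\<close>

text \<open>\<open>blowup_in_large_set\<close> is applied to the neighbourhood of \<open>v\<close>,
  with the low-degree vertices and the forbidden set \<open>Z\<close> together as exceptional
  set.\<close>

lemma blowup_in_neighbourhood:
  fixes \<delta> :: real
  assumes r: "2 \<le> r" and \<delta>: "0 < \<delta>" "\<delta> \<le> 1"
  shows "\<exists>\<eta>>0 :: real. \<exists>N. \<forall>(G :: 'a graph) v Z. sgraph G \<longrightarrow> N \<le> card (verts G) \<longrightarrow>
     (1 - 1 / real r - \<eta>) * real (card (verts G)) ^ 2 / 2 \<le> card (edges G) \<longrightarrow> \<not> has_blowup G (Suc r) t \<longrightarrow>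
     (1 - 1 / real r + \<delta>) * card (verts G) \<le> card (nbs G v) \<longrightarrow> finite Z \<longrightarrow> card Z \<le> z \<longrightarrow>
     has_blowup (induced G (nbs G v - Z)) r k"
proof -
  obtain \<epsilon>0 :: real and N0 where \<epsilon>0: "0 < \<epsilon>0" and N0: "\<forall>(G :: 'a graph) L R. sgraph G \<longrightarrow> N0 \<le> card (verts G) \<longrightarrow>
     R \<subseteq> verts G \<longrightarrow> real (card L) \<le> \<epsilon>0 * card (verts G) \<longrightarrow> finite L \<longrightarrow>
     (\<forall>v\<in>verts G - L. (1 - 1 / real r - \<epsilon>0) * card (verts G) \<le> card (nbs G v)) \<longrightarrow>
     (1 - 1 / real r + \<delta>) * card (verts G) \<le> card R \<longrightarrow> has_blowup (induced G (R - L)) r k"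
    using blowup_in_large_set[OF r \<delta>, of k] by blast
  \<comment> \<open>Half of \<open>\<epsilon>0\<close> is reserved for the low-degree vertices, the
    other half for \<open>Z\<close>.\<close>
  define \<epsilon> where "\<epsilon> = min (1 / 2) (\<epsilon>0 / 2)"
  have "\<epsilon> \<le> 1 / 2" "\<epsilon> \<le> \<epsilon>0 / 2"
    unfolding \<epsilon>_def by (rule min.cobounded1, rule min.cobounded2)
  moreover have "0 < \<epsilon>" using \<epsilon>0 by (simp add: \<epsilon>_def)
  ultimately have \<epsilon>: "0 < \<epsilon>" "\<epsilon> \<le> 1 / 2" "\<epsilon> \<le> \<epsilon>0 / 2" by blast+
  have "1 \<le> r" using r by simp
  from few_low_degree_vertices[OF this \<epsilon>(1,2), of t] obtain \<eta> N1 where \<eta>: "0 < \<eta>" and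
    N1: "\<forall>G :: 'a graph. sgraph G \<longrightarrow> N1 \<le> card (verts G) \<longrightarrow>
     (1 - 1 / real r - \<eta>) * real (card (verts G)) ^ 2 / 2 \<le> card (edges G) \<longrightarrow> \<not> has_blowup G (Suc r) t \<longrightarrow>
     card {v \<in> verts G. card (nbs G v) < (1 - 1 / real r - \<epsilon>) * card (verts G)} \<le> \<epsilon> * card (verts G)"
    by blast
  obtain N2 :: nat where N2: "2 * real z / \<epsilon>0 < real N2" using reals_Archimedean2 by blast
  show ?thesis
  proof (rule exI[of _ \<eta>], intro conjI exI[of _ "max N0 (max N1 N2)"] allI impI)
    fix G :: "'a graph" and v :: 'a and Z :: "'a set"
    let ?n = "real (card (verts G))"
    assume G: "sgraph G" and n: "max N0 (max N1 N2) \<le> card (verts G)"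
      and e: "(1 - 1 / real r - \<eta>) * ?n ^ 2 / 2 \<le> card (edges G)" and free: "\<not> has_blowup G (Suc r) t"
      and v: "(1 - 1 / real r + \<delta>) * ?n \<le> card (nbs G v)" and Z: "finite Z" "card Z \<le> z"
    define L where "L = {v \<in> verts G. card (nbs G v) < (1 - 1 / real r - \<epsilon>) * ?n}"
    have finL: "finite L" using G by (simp add: L_def sgraph_def)
    have "card L \<le> \<epsilon> * ?n" unfolding L_def using N1[rule_format, OF G _ e free] n by simp
    also have "\<dots> \<le> \<epsilon>0 / 2 * ?n" using \<epsilon> by (intro mult_right_mono) auto
    finally have "real (card L) \<le> \<epsilon>0 / 2 * ?n" .
    moreover have "2 * real z / \<epsilon>0 < ?n" using N2 n by linarith
    then have "real z \<le> \<epsilon>0 / 2 * ?n" using \<epsilon>0 by (simp add: field_simps)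
    ultimately have LZ: "real (card (L \<union> Z)) \<le> \<epsilon>0 * ?n" using card_Un_le[of L Z] Z(2) by linarith
    have "has_blowup (induced G (nbs G v - (L \<union> Z))) r k"
    proof (rule N0[rule_format, OF G _ nbs_subset LZ _ _ v])
      fix w assume w: "w \<in> verts G - (L \<union> Z)"
      have "(1 - 1 / real r - \<epsilon>0) * ?n \<le> (1 - 1 / real r - \<epsilon>) * ?n"
        using \<epsilon> by (intro mult_right_mono) auto
      then show "(1 - 1 / real r - \<epsilon>0) * ?n \<le> card (nbs G w)" using w by (auto simp: L_def)
    qed (use n finL Z in auto)
    moreover have "induced G (nbs G v - (L \<union> Z)) = induced (induced G (nbs G v - Z)) (nbs G v - (L \<union> Z))"
      by (auto simp: induced_def)
    ultimately show "has_blowup (induced G (nbs G v - Z)) r k"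
      using has_blowup_induced[of "nbs G v - (L \<union> Z)" "induced G (nbs G v - Z)" r k] by auto
  qed (use \<eta> in simp)
qed

lemma card_edges_le_ex_num:
  assumes "sgraph (G :: nat graph)" "free_of F G"
  shows "card (edges G) \<le> ex_num (card (verts G)) F"
proof -
  obtain M where M: "M \<in> EX_set (card (verts G)) F" using EX_set_nonempty[OF assms(1) refl assms(2)] by blast
  then have "card (edges G) \<le> card (edges M)" using assms unfolding EX_set_def by blast
  then show ?thesis using card_edges_EX_set[OF M] by simp
qed

lemma free_of_copies:
  assumes "sgraph F" "free_of F G" "1 \<le> h" shows "free_of (copies h F) G"
  using assms embeds_copies_component[of _ h F G 0] by (fastforce simp: free_of_iff sgraph_copies)

text \<open>The Turan graph is \<open>F\<close>-free, hence also free of \<open>copies h F\<close>;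
  for n \<ge> 4/\<eta> its linear error is at most \<eta>n^2/2.\<close>

lemma ex_num_ge_turan:
  assumes F: "sgraph F" and r: "1 \<le> r" "r < chromatic_number F" and h: "1 \<le> h"
    and \<eta>: "0 < \<eta>" "4 / \<eta> \<le> real n"
  shows "EX_set n F \<noteq> {}" "(1 - 1 / real r - \<eta>) * real n ^ 2 / 2 \<le> ex_num n F"
    "(1 - 1 / real r - \<eta>) * real n ^ 2 / 2 \<le> ex_num n (copies h F)"
proof -
  have free: "free_of F (turan r n)" by (rule free_of_turan[OF F r])
  have c: "card (verts (turan r n)) = n" by (simp add: verts_turan)
  show "EX_set n F \<noteq> {}" by (rule EX_set_nonempty[OF sgraph_turan c free])
  have "4 \<le> \<eta> * real n" using \<eta> by (simp add: field_simps)
  then have "4 * real n \<le> \<eta> * real n * real n" by (rule mult_right_mono) simp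
  then have "4 * real n \<le> \<eta> * real n ^ 2" by (simp add: power2_eq_square)
  moreover have "(1 - 1 / real r - \<eta>) * real n ^ 2 / 2 = (1 - 1 / real r) * real n ^ 2 / 2 - \<eta> * real n ^ 2 / 2"
    unfolding left_diff_distrib[of "1 - 1 / real r" \<eta>] diff_divide_distrib ..
  ultimately have "(1 - 1 / real r - \<eta>) * real n ^ 2 / 2 \<le> (1 - 1 / real r) * real n ^ 2 / 2 - 2 * real n"
    by simp
  also have "\<dots> \<le> card (edges (turan r n))" by (rule card_edges_turan[OF r(1)])
  finally have *: "(1 - 1 / real r - \<eta>) * real n ^ 2 / 2 \<le> card (edges (turan r n))" .
  have "card (edges (turan r n)) \<le> ex_num n F"
    using card_edges_le_ex_num[OF sgraph_turan free] c by simp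
  then show "(1 - 1 / real r - \<eta>) * real n ^ 2 / 2 \<le> ex_num n F" using * by linarith
  have "card (edges (turan r n)) \<le> ex_num n (copies h F)"
    using card_edges_le_ex_num[OF sgraph_turan free_of_copies[OF F free h]] c by simp
  then show "(1 - 1 / real r - \<eta>) * real n ^ 2 / 2 \<le> ex_num n (copies h F)" using * by linarith
qed

text \<open>An extremal \<open>F\<close>-free graph has nearly the Turan density and no K_(r+1)(k),
  so \<open>large_common_neighbourhood\<close> provides \<open>S\<close> and \<open>W\<close>. A new
  vertex joined to \<open>W\<close> creates no copy of \<open>F\<close> by
  \<open>free_of_add_vertex\<close> and adds |W| edges.\<close>

lemma ex_num_Suc_ge:
  fixes \<epsilon> :: real
  assumes F: "sgraph F" and \<chi>: "chromatic_number F = Suc r" and r: "2 \<le> r" and \<epsilon>: "0 < \<epsilon>"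
  shows "\<exists>N. \<forall>n\<ge>N. ex_num n F + (1 - 1 / real r - \<epsilon>) * n \<le> ex_num (Suc n) F"
proof -
  define k where "k = card (verts F)"
  obtain \<eta> :: real and N where \<eta>: "0 < \<eta>" and N: "\<forall>G :: nat graph. sgraph G \<longrightarrow> N \<le> card (verts G) \<longrightarrow>
     (1 - 1 / real r - \<eta>) * real (card (verts G)) ^ 2 / 2 \<le> card (edges G) \<longrightarrow> \<not> has_blowup G (Suc r) k \<longrightarrow>
     (\<exists>S W. S \<subseteq> verts G \<and> card S = k \<and> W \<subseteq> verts G \<and>
        (1 - 1 / real r - \<epsilon>) * card (verts G) \<le> card W \<and> (\<forall>s\<in>S. W \<subseteq> nbs G s))"
    using large_common_neighbourhood[OF r \<epsilon>, of k] by blast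
  obtain N' :: nat where N': "4 / \<eta> < real N'" using reals_Archimedean2 by blast
  obtain c where c: "proper_coloring F (Suc r) c" using chromatic_number_coloring[OF F] \<chi> by auto
  show ?thesis
  proof (intro exI[of _ "max N N'"] allI impI)
    fix n assume n: "max N N' \<le> n"
    have r': "1 \<le> r" "r < chromatic_number F" using r \<chi> by auto
    have n\<eta>: "4 / \<eta> \<le> real n" using N' n by linarith
    note T = ex_num_ge_turan[OF F r' le_refl \<eta> n\<eta>]
    obtain G where GX: "G \<in> EX_set n F" using T(1) by blast
    then have G: "sgraph G" "card (verts G) = n" "free_of F G" by (auto simp: EX_set_def)
    have cE: "card (edges G) = ex_num n F" by (rule card_edges_EX_set[OF GX])
    have "\<not> has_blowup G (Suc r) k"
      using embed_in_blowup[OF F G(1) c, of k] G(3) unfolding free_of_iff[OF F] k_def by blast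
    then obtain S W where SW: "S \<subseteq> verts G" "card S = k" "W \<subseteq> verts G"
        "(1 - 1 / real r - \<epsilon>) * n \<le> card W" "\<forall>s\<in>S. W \<subseteq> nbs G s"
      using N[rule_format, OF G(1)] T(2) G(2) cE n by auto
    obtain v where v: "v \<notin> verts G" using G(1) ex_new_if_finite[of "verts G"] by (auto simp: sgraph_def)
    have "free_of F (add_vertex G v W)"
      by (rule free_of_add_vertex[OF F G(1,3) v SW(1)]) (use SW in \<open>auto simp: k_def\<close>)
    from card_edges_le_ex_num[OF sgraph_add_vertex[OF G(1) v SW(3)] this]
    have "ex_num n F + card W \<le> ex_num (Suc n) F"
      using card_verts_add_vertex[OF G(1) v] card_edges_add_vertex[OF G(1) v SW(3)] cE G(2) by simp
    then show "ex_num n F + (1 - 1 / real r - \<epsilon>) * n \<le> ex_num (Suc n) F" using SW(4) by linarith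
  qed
qed

lemma ex_num_add_ge:
  fixes c :: real
  assumes "\<forall>n\<ge>N. ex_num n F + c * n \<le> ex_num (Suc n) F" "N \<le> n" "0 \<le> c"
  shows "ex_num n F + s * (c * n) \<le> ex_num (n + s) F"
proof (induction s)
  case (Suc s)
  have "c * n \<le> c * (n + s)" using assms(3) by (intro mult_left_mono) auto
  moreover have "ex_num (n + s) F + c * (n + s) \<le> ex_num (Suc (n + s)) F"
    using assms(1)[rule_format, of "n + s"] assms(2) by simp
  ultimately show ?case using Suc.IH by (simp add: algebra_simps)
qed simp

subsection \<open>Joins with a complete graph\<close>

text \<open>The join of a complete graph on \<open>A\<close> with \<open>H\<close>, kept in the
  vertex type of the host instead of the sum type of \<open>join\<close>. An extremal graph can thus
  be shown equal to a cone by comparing edge sets.\<close>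

definition cone :: "'a set \<Rightarrow> 'a graph \<Rightarrow> 'a graph" where
  "cone A H = (A \<union> verts H, {e. e \<subseteq> A \<union> verts H \<and> card e = 2 \<and> (e \<subseteq> verts H \<longrightarrow> e \<in> edges H)})"

lemma sgraph_cone: "finite A \<Longrightarrow> sgraph H \<Longrightarrow> sgraph (cone A H)"
  by (auto simp: sgraph_def cone_def)

lemma choose_two_add: "(a + w) choose 2 = (a choose 2) + a * w + (w choose 2)"
  by (induction a) (auto simp: numeral_2_eq_2)

lemma card_edges_cone:
  assumes A: "finite A" and H: "sgraph H" and dis: "A \<inter> verts H = {}"
  shows "card (edges (cone A H)) = (card A choose 2) + card A * card (verts H) + card (edges H)"
proof -
  let ?W = "verts H"
  let ?all = "{e. e \<subseteq> A \<union> ?W \<and> card e = 2}" and ?in = "{e. e \<subseteq> ?W \<and> card e = 2}"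
  have finW: "finite ?W" using H by (simp add: sgraph_def)
  have fin: "finite ?all" using A finW by (auto intro: finite_subset[of _ "Pow (A \<union> ?W)"])
  have sub: "?in \<subseteq> ?all" by blast
  have EH: "edges H \<subseteq> ?in" using H by (auto simp: sgraph_def)
  have "edges (cone A H) = (?all - ?in) \<union> edges H" using EH by (auto simp: cone_def)
  moreover have "(?all - ?in) \<inter> edges H = {}" using EH by blast
  ultimately have "card (edges (cone A H)) = card (?all - ?in) + card (edges H)"
    using fin sgraph_finite_edges[OF H] by (simp add: card_Un_disjoint)
  moreover have "card (?all - ?in) = card ?all - card ?in"
    using fin sub by (intro card_Diff_subset) (auto intro: finite_subset)
  moreover have "card ?all = (card A + card ?W) choose 2"
    using n_subsets[of "A \<union> ?W" 2] A finW dis by (simp add: card_Un_disjoint)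
  moreover have "card ?in = card ?W choose 2" using n_subsets[OF finW] .
  ultimately show ?thesis by (simp add: choose_two_add)
qed

text \<open>Each of the \<open>h\<close> disjoint copies must use a vertex of \<open>A\<close>, as
  it would otherwise lie in \<open>H\<close>; but \<open>A\<close> has fewer than \<open>h\<close>
  vertices.\<close>

lemma free_of_cone:
  assumes F: "sgraph F" and free: "free_of F H" and A: "finite A" "card A < h"
  shows "free_of (copies h F) (cone A H)"
  unfolding free_of_iff[OF sgraph_copies[OF F]]
proof
  assume "\<exists>f. embeds_via f (copies h F) (cone A H)"
  then obtain f where f: "embeds_via f (copies h F) (cone A H)" by blast
  have "\<exists>x\<in>verts F. f (i, x) \<in> A" if i: "i < h" for i
  proof (rule ccontr)
    assume neg: "\<not> ?thesis"
    have g: "embeds_via (\<lambda>x. f (i, x)) F (cone A H)" by (rule embeds_copies_component[OF f i])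
    then have sub: "(\<lambda>x. f (i, x)) ` verts F \<subseteq> verts H"
      using neg by (auto simp: embeds_via_def cone_def)
    have "(\<lambda>x. f (i, x)) ` e \<in> edges H" if "e \<in> edges F" for e
    proof -
      have "(\<lambda>x. f (i, x)) ` e \<subseteq> verts H" using sub F that unfolding sgraph_def by blast
      moreover have "(\<lambda>x. f (i, x)) ` e \<in> edges (cone A H)" using g that by (simp add: embeds_via_def)
      ultimately show ?thesis by (simp add: cone_def)
    qed
    then have "embeds_via (\<lambda>x. f (i, x)) F H" using g sub by (simp add: embeds_via_def)
    then show False using free free_of_iff[OF F] by blast
  qed
  then obtain x where x: "\<And>i. i < h \<Longrightarrow> x i \<in> verts F \<and> f (i, x i) \<in> A" by metis
  have "inj_on (\<lambda>i. f (i, x i)) {..<h}"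
  proof (rule inj_onI)
    fix i j assume ij: "i \<in> {..<h}" "j \<in> {..<h}" "f (i, x i) = f (j, x j)"
    have "inj_on f ({..<h} \<times> verts F)" using f by (simp add: embeds_via_def verts_copies)
    from inj_onD[OF this ij(3)] show "i = j" using ij x by auto
  qed
  moreover have "(\<lambda>i. f (i, x i)) ` {..<h} \<subseteq> A" using x by auto
  ultimately have "card {..<h} \<le> card A" using A(1) card_inj_on_le by blast
  then show False using A(2) by simp
qed

lemma isomorphic_cone_join:
  assumes A: "finite A" and H: "sgraph H" and dis: "A \<inter> verts H = {}"
  shows "isomorphic (cone A H) (join (complete_graph (card A)) H)"
proof -
  obtain b where b: "bij_betw b A {..<card A}" using A ex_bij_betw_finite_nat[OF A] atLeast0LessThan by metis
  have inj: "inj_on b A" and im: "b ` A = {..<card A}" using b by (auto simp: bij_betw_def)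
  define f where "f x = (if x \<in> A then Inl (b x) else Inr x)" for x
  have fA: "f x = Inl (b x)" if "x \<in> A" for x using that by (simp add: f_def)
  have fH: "f x = Inr x" if "x \<in> verts H" for x using that dis by (auto simp: f_def)
  have vj: "verts (join (complete_graph (card A)) H) = {..<card A} <+> verts H"
    by (simp add: join_def complete_graph_def)
  have ej: "edges (join (complete_graph (card A)) H) =
      (\<lambda>e. Inl ` e) ` {e. e \<subseteq> {..<card A} \<and> card e = 2} \<union> (\<lambda>e. Inr ` e) ` edges H \<union>
      {{Inl u, Inr v} | u v. u < card A \<and> v \<in> verts H}"
    by (simp add: join_def complete_graph_def)
  have "inj_on f (A \<union> verts H)"
  proof (rule inj_onI)
    fix x y assume "x \<in> A \<union> verts H" "y \<in> A \<union> verts H" "f x = f y"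
    then show "x = y" using inj dis by (auto simp: f_def split: if_splits dest: inj_onD)
  qed
  moreover have "f ` (A \<union> verts H) = {..<card A} <+> verts H"
  proof -
    have "f ` A = Inl ` b ` A" "f ` verts H = Inr ` verts H" using fA fH by (auto simp: image_image)
    then show ?thesis by (simp add: image_Un im Plus_def)
  qed
  ultimately have "bij_betw f (verts (cone A H)) (verts (join (complete_graph (card A)) H))"
    unfolding vj by (simp add: bij_betw_def cone_def)
  moreover have "edges (join (complete_graph (card A)) H) = (\<lambda>e. f ` e) ` edges (cone A H)"
  proof (intro equalityI subsetI)
    fix e' assume "e' \<in> edges (join (complete_graph (card A)) H)"
    then consider d where "e' = Inl ` d" "d \<subseteq> {..<card A}" "card d = 2" | d where "e' = Inr ` d" "d \<in> edges H"
      | u v where "e' = {Inl u, Inr v}" "u < card A" "v \<in> verts H"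
      unfolding ej by blast
    then show "e' \<in> (\<lambda>e. f ` e) ` edges (cone A H)"
    proof cases
      case 1
      then obtain e where e: "e \<subseteq> A" "d = b ` e" using im by (metis subset_imageE)
      have "card e = 2" using 1 e card_image[OF inj_on_subset[OF inj e(1)]] by simp
      moreover have "\<not> e \<subseteq> verts H"
      proof
        assume "e \<subseteq> verts H"
        then have "e = {}" using e(1) dis by blast
        then show False using \<open>card e = 2\<close> by simp
      qed
      ultimately have "e \<in> edges (cone A H)" using e by (auto simp: cone_def)
      moreover have "e' = f ` e" unfolding 1(1) e(2) image_image using fA e(1) by (intro image_cong) auto
      ultimately show ?thesis by blast
    next
      case 2
      then have "d \<subseteq> verts H" "card d = 2" using H by (auto simp: sgraph_def)
      then have "d \<in> edges (cone A H)" using 2 by (auto simp: cone_def)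
      moreover have "e' = f ` d" unfolding 2(1) using fH \<open>d \<subseteq> verts H\<close> by (intro image_cong) auto
      ultimately show ?thesis by blast
    next
      case 3
      then obtain a where a: "a \<in> A" "u = b a" using im by blast
      have "a \<noteq> v" "a \<notin> verts H" using a 3 dis by auto
      then have "{a, v} \<in> edges (cone A H)" using a 3 by (auto simp: cone_def)
      moreover have "e' = f ` {a, v}" using 3 a fA fH by simp
      ultimately show ?thesis by blast
    qed
  next
    fix e' assume "e' \<in> (\<lambda>e. f ` e) ` edges (cone A H)"
    then obtain e where e: "e' = f ` e" "e \<subseteq> A \<union> verts H" "card e = 2" "e \<subseteq> verts H \<longrightarrow> e \<in> edges H"
      by (auto simp: cone_def)
    obtain x y where xy: "e = {x, y}" "x \<noteq> y" using e(3) by (auto simp: card_2_iff)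
    have bA: "b z < card A" if "z \<in> A" for z using im that by auto
    consider "x \<in> A" "y \<in> A" | "x \<in> A" "y \<in> verts H" | "x \<in> verts H" "y \<in> A" | "x \<in> verts H" "y \<in> verts H"
      using e(2) xy by auto
    then show "e' \<in> edges (join (complete_graph (card A)) H)"
    proof cases
      case 1
      have "b x \<noteq> b y" using 1 xy inj by (auto dest: inj_onD)
      then have "{b x, b y} \<in> {e. e \<subseteq> {..<card A} \<and> card e = 2}" using bA 1 by simp
      moreover have "e' = Inl ` {b x, b y}" using e xy 1 fA by simp
      ultimately show ?thesis unfolding ej by blast
    next
      case 2
      then have "e' = {Inl (b x), Inr y}" using e xy fA fH by simp
      then show ?thesis unfolding ej using 2 bA by blast
    next
      case 3
      then have "e' = {Inl (b y), Inr x}" using e xy fA fH by auto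
      then show ?thesis unfolding ej using 3 bA by blast
    next
      case 4
      then have "e' = Inr ` e" using e xy fH by simp
      moreover have "e \<in> edges H" using e(4) xy 4 by simp
      ultimately show ?thesis unfolding ej by blast
    qed
  qed
  ultimately show ?thesis unfolding isomorphic_def by blast
qed

text \<open>The cone over an extremal \<open>F\<close>-free graph on \<open>m\<close> vertices, with
  \<open>l\<close> fresh apex vertices, attains the left-hand side.\<close>

lemma ex_num_copies_ge:
  assumes F: "sgraph F" and ne: "EX_set m F \<noteq> {}" and l: "l < h"
  shows "(l choose 2) + l * m + ex_num m F \<le> ex_num (l + m) (copies h F)"
proof -
  obtain H where HX: "H \<in> EX_set m F" using ne by blast
  then have H: "sgraph H" "card (verts H) = m" "free_of F H" by (auto simp: EX_set_def)
  have finH: "finite (verts H)" using H by (simp add: sgraph_def)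
  obtain A where A: "A \<subseteq> - verts H" "finite A" "card A = l"
    using infinite_arbitrarily_large[of "- verts H" l] finH by (auto simp: Compl_eq_Diff_UNIV)
  have dis: "A \<inter> verts H = {}" using A by blast
  have "card (verts (cone A H)) = l + m"
    using A finH dis H by (simp add: cone_def card_Un_disjoint)
  then show ?thesis
    using card_edges_le_ex_num[OF sgraph_cone[OF A(2) H(1)] free_of_cone[OF F H(3) A(2)]]
      card_edges_cone[OF A(2) H(1) dis] card_edges_EX_set[OF HX] A(3) H(2) l by simp
qed

subsection \<open>Packings in extremal graphs\<close>

text \<open>The vertices of \<open>B\<close> are seeds, each of which is traded for one further copy
  of \<open>F\<close>. The bound \<open>z\<close> allows |F| forbidden vertices for every copy and
  one for every seed.\<close>

lemma extend_packing:
  assumes F: "sgraph F"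
    and step: "\<And>v Z. v \<in> A \<Longrightarrow> v \<notin> Z \<Longrightarrow> finite Z \<Longrightarrow> card Z \<le> z \<Longrightarrow>
      \<exists>g. embeds_via g F G \<and> g ` verts F \<inter> Z = {}"
    and B: "finite B" "B \<subseteq> A"
    and f: "embeds_via f (copies j F) G" "f ` verts (copies j F) \<inter> B = {}"
    and z: "(j + card B) * (card (verts F) + 1) \<le> z"
  shows "\<exists>f. embeds_via f (copies (j + card B) F) G"
  using B f z
proof (induction B arbitrary: j f rule: finite_induct)
  case empty
  then show ?case by auto
next
  case (insert b B)
  \<comment> \<open>The new copy avoids the earlier copies and also the seeds still waiting, so that
    these can be used later.\<close>
  let ?k = "card (verts F)" and ?Z = "f ` verts (copies j F) \<union> B"
  have finI: "finite (f ` verts (copies j F))" using sgraph_copies[OF F, of j] by (simp add: sgraph_def)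
  have "card (f ` verts (copies j F)) \<le> card (verts (copies j F))"
    using sgraph_copies[OF F, of j] by (intro card_image_le) (simp add: sgraph_def)
  also have "\<dots> = j * ?k" by (simp add: verts_copies card_cartesian_product)
  finally have "card ?Z \<le> j * ?k + card B" using card_Un_le[of "f ` verts (copies j F)" B] by linarith
  also have "\<dots> \<le> (j + card (insert b B)) * (?k + 1)"
    using insert.hyps by (simp add: algebra_simps)
  finally have "card ?Z \<le> z" using insert.prems(4) by linarith
  moreover have "b \<notin> ?Z" using insert.hyps insert.prems(3) by blast
  ultimately obtain g where g: "embeds_via g F G" "g ` verts F \<inter> ?Z = {}"
    using step[of b ?Z] insert.prems(1) insert.hyps(1) finI by blast
  let ?h = "\<lambda>p. if fst p = j then g (snd p) else f p"
  have "embeds_via ?h (copies (Suc j) F) G"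
    using g by (intro embeds_copies_Suc[OF F insert.prems(2)]) blast+
  moreover have "?h ` verts (copies (Suc j) F) \<inter> B = {}"
  proof -
    have "?h p \<in> f ` verts (copies j F) \<union> g ` verts F" if "p \<in> verts (copies (Suc j) F)" for p
      using that by (auto simp: verts_copies)
    then show ?thesis using g(2) insert.prems(3) by blast
  qed
  moreover have "(Suc j + card B) * (?k + 1) \<le> z" using insert.prems(4) insert.hyps by simp
  ultimately have "\<exists>f. embeds_via f (copies (Suc j + card B) F) G"
    using insert.IH insert.prems(1) by blast
  then show ?case using insert.hyps by simp
qed

lemma last_index_exists:
  assumes "\<And>j. P j \<Longrightarrow> j < (h :: nat)" "P 0"
  obtains m where "P m" "\<not> P (Suc m)"
proof -
  have "P (GREATEST j. P j)" using assms by (intro GreatestI_nat[of P 0 h]) (auto dest: less_imp_le)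
  moreover have "\<not> P (Suc (GREATEST j. P j))"
    using Greatest_le_nat[of P "Suc (GREATEST j. P j)" h] assms(1) by (auto dest: less_imp_le)
  ultimately show thesis by (rule that)
qed

text \<open>Here H = h - 1, a = |A|, \<open>E0\<close> and \<open>E1\<close> are the extremal
  numbers for \<open>F\<close> on n0 and n - H vertices, and s is the difference of these two
  orders. The terms Mpn cancel, and (H - a)n/r \<le> 2M\<epsilon>n + 3M^2 remains. As H - a \<ge> 1
  and 2M\<epsilon> = 1/(2r), this contradicts n > 6rM^2.\<close>

lemma extremal_count_contradiction:
  fixes n M H a p \<epsilon> s n0 E0 E1 e r :: real
  assumes p: "p = 1 - 1 / r" and r: "2 \<le> r" and M: "1 \<le> M" and \<epsilon>: "\<epsilon> = 1 / (4 * r * M)"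
    and a: "0 \<le> a" "a + 1 \<le> H" "H \<le> M" and s: "s = M + a - H" and n0: "n0 = n - a - M"
    and n: "6 * r * M ^ 2 < n"
    and inc: "E0 + s * ((p - \<epsilon>) * n0) \<le> E1" and lower: "H * (n - H) + E1 \<le> e"
    and upper: "e \<le> E0 + a * n + M * ((p + \<epsilon>) * n)"
  shows False
proof -
  have n': "0 < n" using n r M by (smt (verit) mult_nonneg_nonneg zero_le_power)
  have \<epsilon>0: "0 < \<epsilon>" using \<epsilon> r M by simp
  have M\<epsilon>: "M * \<epsilon> = 1 / (4 * r)" using \<epsilon> M by simp
  have "0 \<le> 1 / r" using r by simp
  then have p1: "p - \<epsilon> \<le> 1" using p \<epsilon>0 by linarith
  have s0: "0 \<le> s" "s \<le> M" using s a by auto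
  \<comment> \<open>Replacing \<open>n0\<close> by \<open>n\<close> in the growth term costs only a
    bounded amount.\<close>
  have "s * ((p - \<epsilon>) * (a + M)) \<le> M * (1 * (2 * M))"
  proof (cases "0 \<le> p - \<epsilon>")
    case True
    then show ?thesis using s0 p1 a M by (intro mult_mono) auto
  next
    case False
    then have "s * ((p - \<epsilon>) * (a + M)) \<le> 0"
      using s0 a M by (intro mult_nonneg_nonpos mult_nonpos_nonneg) auto
    then show ?thesis using M by (smt (verit) mult_nonneg_nonneg)
  qed
  moreover have "s * ((p - \<epsilon>) * n0) = s * ((p - \<epsilon>) * n) - s * ((p - \<epsilon>) * (a + M))"
    unfolding n0 by (simp add: algebra_simps)
  moreover have "s * ((p - \<epsilon>) * n) = M * (p * n) - (H - a) * (p * n) - s * (\<epsilon> * n)"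
    unfolding s by (simp add: algebra_simps)
  moreover have "s * (\<epsilon> * n) \<le> M * (\<epsilon> * n)" using s0 \<epsilon>0 n' by (intro mult_right_mono) auto
  moreover have "M * ((p + \<epsilon>) * n) = M * (p * n) + M * (\<epsilon> * n)" by (simp add: algebra_simps)
  moreover have "H * (n - H) = H * n - H * H" by (simp add: algebra_simps)
  moreover have "H * H \<le> M * M" using a by (intro mult_mono) auto
  ultimately have 1: "(H - a) * n - (H - a) * (p * n) \<le> 2 * (M * (\<epsilon> * n)) + 3 * (M * M)"
    using inc lower upper by (simp add: algebra_simps)
  have 2: "(H - a) * n - (H - a) * (p * n) = (H - a) * (n / r)"
    unfolding p by (simp add: algebra_simps)
  have 3: "1 * (n / r) \<le> (H - a) * (n / r)" using a n' r by (intro mult_right_mono) auto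
  have 4: "2 * (M * (\<epsilon> * n)) = n / r / 2"
  proof -
    have "2 * (M * (\<epsilon> * n)) = 2 * (M * \<epsilon>) * n" by simp
    then show ?thesis unfolding M\<epsilon> using r by (simp add: field_simps)
  qed
  have "n / r \<le> n / r / 2 + 3 * (M * M)" using order_trans[OF 3 1[unfolded 2 4]] by simp
  moreover have "x \<le> 6 * y" if "x \<le> x / 2 + 3 * y" for x y :: real using that by linarith
  ultimately have "n / r \<le> 6 * (M * M)" by blast
  then have "n \<le> 6 * (M * M) * r" using r by (simp add: field_simps)
  then show False using n by (simp add: power2_eq_square algebra_simps)
qed

text \<open>The set sought consists of all vertices of degree at least (p + \<epsilon>)n. At most h
  - 1 such vertices exist by packing, and fewer are ruled out by counting edges.\<close>

lemma extremal_structure: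
  assumes F: "sgraph F" and crit: "vertex_critical F" and \<chi>: "chromatic_number F = Suc r" and r: "2 \<le> r"
    and h: "2 \<le> h"
  shows "\<exists>N. \<forall>n\<ge>N. \<forall>G\<in>EX_set n (copies h F).
    \<exists>A\<subseteq>verts G. card A = h - 1 \<and> free_of F (induced G (verts G - A))"
proof -
  define p where "p = 1 - 1 / real r"
  define k where "k = card (verts F)"
  define M where "M = h * k"
  obtain u where u: "u \<in> verts F" "chromatic_number (del_vert F u) = r"
    using crit \<chi> unfolding vertex_critical_def by auto
  have k: "1 \<le> k" using u(1) F card_gt_0_iff[of "verts F"] by (auto simp: k_def sgraph_def)
  have hM: "h \<le> M" using k by (simp add: M_def)
  have M1: "1 \<le> real M" using hM h by linarith
  obtain c where c: "proper_coloring F (Suc r) c" using chromatic_number_coloring[OF F] \<chi> by auto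
  obtain d where d: "proper_coloring (del_vert F u) r d"
    using chromatic_number_coloring[OF sgraph_del_vert[OF F, of u]] u(2) by auto
  \<comment> \<open>With this value the two error terms M\<epsilon>n of the edge count consume only
    half of the gain n/r.\<close>
  define \<epsilon> where "\<epsilon> = 1 / (4 * real r * real M)"
  have "4 * real r * 1 \<le> 4 * real r * real M" using r M1 by (intro mult_left_mono) auto
  then have rM: "2 \<le> 4 * real r * real M" using r by linarith
  have "1 / (4 * real r * real M) \<le> 1 / 2" using rM by (intro divide_left_mono) auto
  moreover have "0 < 1 / (4 * real r * real M)" using rM by simp
  ultimately have \<epsilon>: "0 < \<epsilon>" "\<epsilon> \<le> 1 / 2" unfolding \<epsilon>_def by blast+
  have r2: "1 / real r \<le> 1 / 2" using r by (simp add: field_simps)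
  then have p\<epsilon>: "0 \<le> p - \<epsilon>" using \<epsilon> by (simp add: p_def)
  obtain \<eta> :: real and N1 where \<eta>: "0 < \<eta>" and N1: "\<forall>(G :: nat graph) v Z. sgraph G \<longrightarrow> N1 \<le> card (verts G) \<longrightarrow>
     (1 - 1 / real r - \<eta>) * real (card (verts G)) ^ 2 / 2 \<le> card (edges G) \<longrightarrow> \<not> has_blowup G (Suc r) M \<longrightarrow>
     (1 - 1 / real r + \<epsilon>) * card (verts G) \<le> card (nbs G v) \<longrightarrow> finite Z \<longrightarrow> card Z \<le> h * (k + 1) \<longrightarrow>
     has_blowup (induced G (nbs G v - Z)) r k"
    using blowup_in_neighbourhood[OF r \<epsilon>(1), of M "h * (k + 1)" k] \<epsilon>(2) by fastforce
  obtain N2 where N2: "\<forall>n\<ge>N2. ex_num n F + (1 - 1 / real r - \<epsilon>) * n \<le> ex_num (Suc n) F"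
    using ex_num_Suc_ge[OF F \<chi> r \<epsilon>(1)] by blast
  obtain N3 :: nat where N3: "4 / \<eta> < real N3" using reals_Archimedean2 by blast
  obtain N4 :: nat where N4: "6 * real r * real M ^ 2 < real N4" using reals_Archimedean2 by blast
  define N where "N = N1 + N2 + N3 + N4 + 2 * h + 2 * M"
  show ?thesis
  proof (intro exI[of _ N] allI impI ballI)
    fix n G assume n: "N \<le> n" and GX: "G \<in> EX_set n (copies h F)"
    then have G: "sgraph G" and cV: "card (verts G) = n" and free: "free_of (copies h F) G"
      by (auto simp: EX_set_def)
    have finV: "finite (verts G)" using G by (simp add: sgraph_def)
    have nofree: "\<not> embeds_via f (copies h F) G" for f
      using free free_of_iff[OF sgraph_copies[OF F]] by blast
    have cE: "card (edges G) = ex_num n (copies h F)" by (rule card_edges_EX_set[OF GX])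
    have r': "1 \<le> r" "r < chromatic_number F" using r \<chi> by auto
    have "4 / \<eta> \<le> real n" using N3 n by (simp add: N_def)
    note T = ex_num_ge_turan(3)[OF F r' _ \<eta> this, of h]
    have dense: "(1 - 1 / real r - \<eta>) * real (card (verts G)) ^ 2 / 2 \<le> card (edges G)"
      using T h unfolding cV cE by simp
    have cc: "card (verts (copies h F)) = M"
      by (simp add: verts_copies card_cartesian_product M_def k_def)
    \<comment> \<open>\<open>copies h F\<close> has \<open>M\<close> vertices and is (r +
      1)-colourable, so it would embed into K_(r+1)(M).\<close>
    have nob: "\<not> has_blowup G (Suc r) M"
      using embed_in_blowup[OF sgraph_copies[OF F] G proper_coloring_copies[OF c], of h M] cc nofree by auto
    define A where "A = {v \<in> verts G. (p + \<epsilon>) * n \<le> card (nbs G v)}"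
    have AV: "A \<subseteq> verts G" by (auto simp: A_def)
    have finA: "finite A" using AV finV by (rule finite_subset)
    have step: "\<exists>g. embeds_via g F G \<and> g ` verts F \<inter> Z = {}"
      if v: "v \<in> A" "v \<notin> Z" and Z: "finite Z" "card Z \<le> h * (k + 1)" for v Z
    proof -
      let ?S = "nbs G v - Z"
      have vV: "v \<in> verts G" using v AV by blast
      have SV: "?S \<subseteq> verts G" using nbs_subset[of G v] by blast
      have bl: "has_blowup (induced G ?S) r k"
        by (rule N1[rule_format, OF G _ dense nob _ Z]) (use v n cV in \<open>auto simp: A_def p_def N_def\<close>)
      have "card (verts (del_vert F u)) \<le> k"
        using F by (auto simp: del_vert_def k_def sgraph_def intro: card_mono)
      from embed_in_blowup[OF sgraph_del_vert[OF F] sgraph_induced[OF G SV] d this bl]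
      obtain f where f: "embeds_via f (del_vert F u) (induced G ?S)" by blast
      have e: "embeds_via (f(u := v)) F (induced G (insert v ?S))"
        by (rule embed_through_vertex[OF F G u(1) vV _ f]) blast
      then have "embeds_via (f(u := v)) F G" using SV vV by (intro embeds_via_induced[OF _ e]) blast
      moreover have "(f(u := v)) ` verts F \<inter> Z = {}"
      proof -
        have "(f(u := v)) ` verts F \<subseteq> insert v ?S" using e unfolding embeds_via_def verts_induced by blast
        then show ?thesis using v(2) by auto
      qed
      ultimately show ?thesis by (intro exI[of _ "f(u := v)"] conjI)
    qed
    have packing: "j + card B < h"
      if "B \<subseteq> A" "embeds_via f (copies j F) G" "f ` verts (copies j F) \<inter> B = {}" for B j f
    proof (rule ccontr)
      assume "\<not> j + card B < h"
      \<comment> \<open>The packing is cut down to at most \<open>h\<close> copies and completed by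
        exactly \<open>h - i\<close> seeds, which keeps the forbidden sets within h(k + 1)
        vertices.\<close>
      define i where "i = min j h"
      have "h - i \<le> card B" using \<open>\<not> j + card B < h\<close> by (simp add: i_def)
      then obtain B' where B': "B' \<subseteq> B" "card B' = h - i" by (meson obtain_subset_with_card_n)
      have ih: "i + card B' = h" using B' by (simp add: i_def)
      have "f ` verts (copies i F) \<subseteq> f ` verts (copies j F)" by (auto simp: verts_copies i_def)
      then have dis: "f ` verts (copies i F) \<inter> B' = {}" using that(3) B'(1) by blast
      have emb: "embeds_via f (copies i F) G" by (rule embeds_copies_mono[OF that(2)]) (simp add: i_def)
      have "\<exists>f. embeds_via f (copies (i + card B') F) G"
      proof (rule extend_packing[OF F step _ _ emb dis])
        show "B' \<subseteq> A" using B'(1) that(1) by blast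
        then show "finite B'" using finA by (rule finite_subset)
        show "(i + card B') * (card (verts F) + 1) \<le> h * (k + 1)" unfolding ih k_def by simp
      qed
      then show False using nofree ih by simp
    qed
    let ?P = "\<lambda>j. \<exists>f. embeds_via f (copies j F) (induced G (verts G - A))"
    have Pless: "j + card A < h" if Pj: "?P j" for j
    proof -
      obtain f where f: "embeds_via f (copies j F) (induced G (verts G - A))" using Pj by blast
      have "embeds_via f (copies j F) G" by (rule embeds_via_induced[OF _ f]) blast
      moreover have "f ` verts (copies j F) \<inter> A = {}" using f by (auto simp: embeds_via_def)
      ultimately show ?thesis by (intro packing[OF order_refl])
    qed
    have P0: "?P 0" by (simp add: embeds_via_def copies_def)
    obtain m where m: "?P m" "\<not> ?P (Suc m)"
      using last_index_exists[of ?P h] Pless P0 by (metis add_lessD1)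
    obtain f where f: "embeds_via f (copies m F) (induced G (verts G - A))" using m(1) by blast
    define C0 where "C0 = f ` verts (copies m F)"
    have C0V: "C0 \<subseteq> verts G - A" using f by (simp add: C0_def embeds_via_def)
    have ma: "m + card A < h" by (rule Pless[OF m(1)])
    \<comment> \<open>By maximality of \<open>m\<close>, every copy of \<open>F\<close> outside
      \<open>A\<close> meets \<open>C0\<close>.\<close>
    have freeC: "free_of F (induced G (verts G - A - C))" if "C0 \<subseteq> C" for C
      unfolding free_of_iff[OF F]
    proof
      assume "\<exists>g. embeds_via g F (induced G (verts G - A - C))"
      then obtain g where g: "embeds_via g F (induced G (verts G - A - C))" by blast
      have "embeds_via g F (induced G (verts G - A))"
        using g unfolding embeds_via_def verts_induced edges_induced by blast
      moreover have "f ` verts (copies m F) \<inter> g ` verts F = {}"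
        using g that by (auto simp: embeds_via_def C0_def)
      ultimately have "?P (Suc m)" using embeds_copies_Suc[OF F f] by blast
      then show False using m(2) by blast
    qed
    show "\<exists>A\<subseteq>verts G. card A = h - 1 \<and> free_of F (induced G (verts G - A))"
    proof (cases "card A = h - 1")
      case True
      \<comment> \<open>When \<open>A\<close> has h - 1 vertices, no copy of \<open>F\<close> fits
        outside it, and the packing is empty.\<close>
      then have "m = 0" using ma by linarith
      then have "C0 = {}" by (simp add: C0_def verts_copies)
      then have "free_of F (induced G (verts G - A))" using freeC[of "{}"] by simp
      then show ?thesis using True AV by blast
    next
      case False
      define a where "a = card A"
      have a: "a + 1 \<le> h - 1" using ma False by (simp add: a_def)
      have "card C0 \<le> card (verts (copies m F))" unfolding C0_def
        using sgraph_copies[OF F, of m] by (intro card_image_le) (simp add: sgraph_def)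
      also have "\<dots> = m * k" by (simp add: verts_copies card_cartesian_product k_def)
      also have "\<dots> \<le> M" unfolding M_def using ma by (intro mult_right_mono) auto
      finally have "card C0 \<le> M" .
      txt \<open>
        Padding the packing to exactly \<open>M \<ge> h - 1\<close> vertices leaves at most \<open>n - (h - 1)\<close> of them, so that
        only the lower bound on the growth of \<open>ex\<close> is needed.
      \<close>
      moreover have cVA: "card (verts G - A) = n - a"
        using AV finA cV by (simp add: card_Diff_subset a_def)
      moreover have "M \<le> n - a" using n a by (simp add: N_def)
      ultimately obtain C where C: "C0 \<subseteq> C" "C \<subseteq> verts G - A" "card C = M"
        using exists_subset_between[of C0 M "verts G - A"] C0V finV by auto
      have finC: "finite C" using C(2) finV by (meson finite_Diff finite_subset)
      have AC: "A \<inter> C = {}" "A \<union> C \<subseteq> verts G" using C(2) AV by auto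
      define n0 where "n0 = n - a - M"
      have VAC: "verts G - A - C = verts G - (A \<union> C)" by blast
      have n0c: "card (verts G - A - C) = n0"
        using C finC cVA by (simp add: card_Diff_subset n0_def)
      have "sgraph (induced G (verts G - A - C))" by (rule sgraph_induced[OF G]) blast
      from card_edges_le_ex_num[OF this freeC[OF C(1)]]
      have E0: "card (edges (induced G (verts G - A - C))) \<le> ex_num n0 F" using n0c by simp
      have "(\<Sum>v\<in>A. real (card (nbs G v))) \<le> (\<Sum>v\<in>A. real n)"
        using card_mono[OF finV nbs_subset[of G]] cV by (intro sum_mono) simp
      then have sA: "(\<Sum>v\<in>A. real (card (nbs G v))) \<le> real a * n" by (simp add: a_def)
      have "(\<Sum>v\<in>C. real (card (nbs G v))) \<le> (\<Sum>v\<in>C. (p + \<epsilon>) * n)"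
        using C(2) by (intro sum_mono) (force simp: A_def)
      then have sC: "(\<Sum>v\<in>C. real (card (nbs G v))) \<le> M * ((p + \<epsilon>) * n)" using C(3) by simp
      have "card (edges G) \<le> card (edges (induced G (verts G - (A \<union> C)))) + (\<Sum>v\<in>A \<union> C. card (nbs G v))"
        by (rule card_edges_le_delete[OF G AC(2)])
      then have "real (card (edges G)) \<le> real (card (edges (induced G (verts G - A - C)))) +
          (\<Sum>v\<in>A \<union> C. real (card (nbs G v)))"
        unfolding VAC of_nat_sum[symmetric] of_nat_add[symmetric] by (simp only: of_nat_le_iff)
      also have "(\<Sum>v\<in>A \<union> C. real (card (nbs G v))) =
          (\<Sum>v\<in>A. real (card (nbs G v))) + (\<Sum>v\<in>C. real (card (nbs G v)))"
        using finA finC AC(1) by (rule sum.union_disjoint)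
      finally have upper: "real (card (edges G)) \<le> real (ex_num n0 F) + real a * n + M * ((p + \<epsilon>) * n)"
        using E0 sA sC by linarith
      define s where "s = M + a - (h - 1)"
      have ns: "n0 + s = n - (h - 1)" using n a hM by (simp add: n0_def s_def N_def)
      have "N2 \<le> n0" using n a hM by (simp add: n0_def N_def)
      have inc: "ex_num n0 F + s * ((p - \<epsilon>) * n0) \<le> ex_num (n - (h - 1)) F"
        using ex_num_add_ge[OF N2 \<open>N2 \<le> n0\<close>, of s] p\<epsilon> unfolding ns p_def by simp
      have "4 / \<eta> \<le> real (n - (h - 1))" using N3 n by (simp add: N_def)
      from ex_num_ge_turan(1)[OF F r' le_refl \<eta> this]
      have ne: "EX_set (n - (h - 1)) F \<noteq> {}" .
      \<comment> \<open>The cone bound without its binomial term, which is bounded and can be given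
        away.\<close>
      have "(h - 1) * (n - (h - 1)) + ex_num (n - (h - 1)) F \<le> card (edges G)"
        using ex_num_copies_ge[OF F ne, of "h - 1" h] h n unfolding cE by (simp add: N_def)
      then have "real ((h - 1) * (n - (h - 1)) + ex_num (n - (h - 1)) F) \<le> real (card (edges G))"
        by (rule of_nat_mono)
      then have lower: "real (h - 1) * (real n - real (h - 1)) + real (ex_num (n - (h - 1)) F) \<le> real (card (edges G))"
        using n by (simp add: N_def of_nat_diff)
      have False
      proof (rule extremal_count_contradiction[OF p_def _ M1 \<epsilon>_def _ _ _ _ _ _ inc lower upper])
        show "real a + 1 \<le> real (h - 1)" "real (h - 1) \<le> real M" using a hM by linarith+
        show "real s = real M + real a - real (h - 1)" using a hM by (simp add: s_def of_nat_diff)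
        show "real n0 = real n - real a - real M" using n a hM by (simp add: n0_def N_def of_nat_diff)
        show "6 * real r * real M ^ 2 < real n" using N4 n by (simp add: N_def)
      qed (use r in auto)
      then show ?thesis ..
    qed
  qed
qed

section \<open>The extremal number and the extremal graphs of hF\<close>

theorem theorem4:
  fixes F :: "'a graph" and h :: nat
  assumes "sgraph F" and "vertex_critical F" and "chromatic_number F \<ge> 3" and "h \<ge> 2"
  shows "\<forall>\<^sub>F n in sequentially.
    ex_num n (copies h F) =
      (MAX l\<in>{1..h}. ((l - 1) choose 2) + (l - 1) * (n - l + 1) + ex_num (n - l + 1) F) \<and>
    (MAX l\<in>{1..h}. ((l - 1) choose 2) + (l - 1) * (n - l + 1) + ex_num (n - l + 1) F) =
      ((h - 1) choose 2) + (h - 1) * (n - h + 1) + ex_num (n - h + 1) F \<and>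
    (\<forall>G\<in>EX_set n (copies h F). \<exists>H\<in>EX_set (n - h + 1) F.
       isomorphic G (join (complete_graph (h - 1)) H))"
proof -
  define r where "r = chromatic_number F - 1"
  have r: "2 \<le> r" "chromatic_number F = Suc r" using assms(3) by (auto simp: r_def)
  then have r': "1 \<le> r" "r < chromatic_number F" by auto
  obtain N where N: "\<forall>n\<ge>N. \<forall>G\<in>EX_set n (copies h F).
    \<exists>A\<subseteq>verts G. card A = h - 1 \<and> free_of F (induced G (verts G - A))"
    using extremal_structure[OF assms(1,2) r(2,1) assms(4)] by blast
  show ?thesis unfolding eventually_sequentially
  proof (rule exI[of _ "N + h"], intro allI impI)
    fix n assume n: "N + h \<le> n"
    \<comment> \<open>\<open>n - l + 1\<close> reads as (n - l) + 1 on naturals; for 1 \<le> l \<le>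
      h \<le> n it is the number of vertices left after removing l - 1.\<close>
    define g where "g l = ((l - 1) choose 2) + (l - 1) * (n - l + 1) + ex_num (n - l + 1) F" for l
    define X where "X = ex_num n (copies h F)"
    have ne: "EX_set m F \<noteq> {}" for m
      by (rule EX_set_nonempty[OF sgraph_turan[of r m] _ free_of_turan[OF assms(1) r']]) (simp add: verts_turan)
    have g_le: "g l \<le> X" if "l \<in> {1..h}" for l
    proof -
      have "g l \<le> ex_num (l - 1 + (n - l + 1)) (copies h F)"
        unfolding g_def by (rule ex_num_copies_ge[OF assms(1) ne]) (use that in auto)
      moreover have "l - 1 + (n - l + 1) = n" using that n by simp
      ultimately show ?thesis by (simp only: X_def)
    qed
    have gh: "g h \<le> X" by (rule g_le) (use assms(4) in simp)
    have main: "X = g h \<and> (\<exists>H\<in>EX_set (n - h + 1) F. isomorphic G (join (complete_graph (h - 1)) H))"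
      if GX: "G \<in> EX_set n (copies h F)" for G
    proof -
      have G: "sgraph G" "card (verts G) = n" using GX by (auto simp: EX_set_def)
      have cE: "card (edges G) = X" unfolding X_def by (rule card_edges_EX_set[OF GX])
      obtain A where A: "A \<subseteq> verts G" "card A = h - 1" "free_of F (induced G (verts G - A))"
        using N GX n by (meson add_leD1)
      define H where "H = induced G (verts G - A)"
      have finA: "finite A" using A(1) G(1) by (auto simp: sgraph_def intro: finite_subset)
      have H: "sgraph H" unfolding H_def by (rule sgraph_induced[OF G(1)]) blast
      have cH: "card (verts H) = n - h + 1"
        using A(1,2) finA G(2) n assms(4) by (simp add: H_def card_Diff_subset)
      have dis: "A \<inter> verts H = {}" by (auto simp: H_def)
      have V: "verts (cone A H) = verts G" using A(1) by (auto simp: cone_def H_def)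
      have sub: "edges G \<subseteq> edges (cone A H)"
        using G(1) A(1) by (auto simp: cone_def H_def sgraph_def)
      have fin: "finite (edges (cone A H))" by (rule sgraph_finite_edges[OF sgraph_cone[OF finA H]])
      have cc: "card (edges (cone A H)) = ((h - 1) choose 2) + (h - 1) * (n - h + 1) + card (edges H)"
        using card_edges_cone[OF finA H dis] A(2) cH by simp
      have HX: "card (edges H) \<le> ex_num (n - h + 1) F"
        using card_edges_le_ex_num[OF H] A(3) cH by (simp add: H_def)
      \<comment> \<open>\<open>G\<close> is a spanning subgraph of the cone over \<open>H\<close>,
        which has at most \<open>g h\<close> edges, and \<open>g h \<le> X\<close>. All these bounds
        are therefore equalities: \<open>G\<close> is the cone itself and \<open>H\<close> is
        extremal.\<close>
      have "X \<le> card (edges (cone A H))" using card_mono[OF fin sub] cE by simp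
      then have eq: "X = g h" "card (edges H) = ex_num (n - h + 1) F" "card (edges (cone A H)) = X"
        using cc HX gh unfolding g_def by linarith+
      have "edges G = edges (cone A H)" using card_subset_eq[OF fin sub] eq(3) cE by simp
      then have "G = cone A H" using V by (simp add: prod_eq_iff)
      then have "isomorphic G (join (complete_graph (h - 1)) H)"
        using isomorphic_cone_join[OF finA H dis] A(2) by simp
      moreover have "H \<in> EX_set (n - h + 1) F"
        unfolding EX_set_def using H cH A(3) eq(2) card_edges_le_ex_num[of _ F]
        by (auto simp: H_def) (metis fst_conv snd_conv)
      ultimately show ?thesis using eq(1) by blast
    qed
    have "EX_set n (copies h F) \<noteq> {}"
      by (rule EX_set_nonempty[OF sgraph_turan[of r n] _ free_of_copies[OF assms(1) free_of_turan[OF assms(1) r']]])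
        (use assms(4) in \<open>auto simp: verts_turan\<close>)
    then have Xg: "X = g h" using main by blast
    \<comment> \<open>Every term is at most \<open>X\<close>, and the term for \<open>h\<close>
      equals \<open>X\<close>; this determines the maximum.\<close>
    have "Max (g ` {1..h}) = g h"
      using assms(4) g_le Xg by (intro Max_eqI) auto
    then show "ex_num n (copies h F) =
      (MAX l\<in>{1..h}. ((l - 1) choose 2) + (l - 1) * (n - l + 1) + ex_num (n - l + 1) F) \<and>
    (MAX l\<in>{1..h}. ((l - 1) choose 2) + (l - 1) * (n - l + 1) + ex_num (n - l + 1) F) =
      ((h - 1) choose 2) + (h - 1) * (n - h + 1) + ex_num (n - h + 1) F \<and>
    (\<forall>G\<in>EX_set n (copies h F). \<exists>H\<in>EX_set (n - h + 1) F.
       isomorphic G (join (complete_graph (h - 1)) H))"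
      using Xg main unfolding g_def X_def by auto
  qed
qed

end
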